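(* Let $a,b,c$ be nonnegative integers with $a>1$, $c>1$ and such that $(a-1,b,c-1)$ is admissible (hence so is $(a,b,c)$). Then, as functions on $\mathrm{SL}(2,\mathbb{C})\times \mathrm{SL}(2,\mathbb{C})$, with $x=\mathrm{tr}(\mathbf{x}_1)$, $$\chi^{a,b,c}=x\cdot\chi^{a-1,b,c-1}-\frac{(a+b-c)^2}{4a(a-1)}\chi^{a-2,b,c}-\frac{(-a+b+c)^2}{4c(c-1)}\chi^{a,b,c-2}-\frac{(a+b+c)^2(a-b+c-2)^2}{16a(a-1)c(c-1)}\chi^{a-2,b,c-2}.$$ The relation still holds for $a=1$ or $c=1$ (with $a,c\ge 1$ and $(a-1,b,c-1)$ admissible), provided the terms having a vanishing factor $a-1$ or $c-1$ in the denominator are excluded.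
   Context: Let $G=\mathrm{SL}(2,\mathbb{C})$ and $V=\mathbb{C}^2$ with standard basis $e_1,e_2$. A triple $(a,b,c)$ of nonnegative integers is admissible if $\alpha=\tfrac12(-a+b+c)$, $\beta=\tfrac12(a-b+c)$, $\gamma=\tfrac12(a+b-c)$ are all nonnegative integers. Let $P_n:V^{\otimes n}\to V^{\otimes n}$ be the symmetrizer $v_1\otimes\cdots\otimes v_n\mapsto\frac1{n!}\sum_{\sigma\in\Sigma_n}v_{\sigma(1)}\otimes\cdots\otimes v_{\sigma(n)}$, and let $V_n\subset V^{\otimes n}$ be its image (isomorphic to $\mathrm{Sym}^nV$). Let $\mathrm{cup}:\mathbb{C}\to V\otimes V$, $1\mapsto e_1\otimes e_2-e_2\otimes e_1$, and $\mathrm{cap}:V\otimes V\to\mathbb{C}$, $v\otimes w\mapsto\det[v\ w]$. Define nested versions by $\mathrm{cup}_0=\mathrm{cap}_0=1$, $\mathrm{cup}_n=(\mathrm{id}_{V^{\otimes (n-1)}}\otimes\mathrm{cup}\otimes\mathrm{id}_{V^{\otimes (n-1)}})\circ\mathrm{cup}_{n-1}:\mathbb{C}\to V^{\otimes n}\otimes V^{\otimes n}$, $\mathrm{cap}_n=\mathrm{cap}_{n-1}\circ(\mathrm{id}_{V^{\otimes (n-1)}}\otimes\mathrm{cap}\otimes\mathrm{id}_{V^{\otimes (n-1)}}):V^{\otimes n}\otimes V^{\otimes n}\to\mathbb{C}$. For an admissible triple define $\iota^{a,b}_c=(P_a\otimes P_b)\circ(\mathrm{id}_{V^{\otimes\beta}}\otimes\mathrm{cup}_\gamma\otimes\mathrm{id}_{V^{\otimes\alpha}})|_{V_c}:V_c\to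 V_a\otimes V_b$ and $\pi^c_{a,b}=P_c\circ(\mathrm{id}_{V^{\otimes\beta}}\otimes\mathrm{cap}_\gamma\otimes\mathrm{id}_{V^{\otimes\alpha}})|_{V_a\otimes V_b}:V_a\otimes V_b\to V_c$. The central function $\chi^{a,b,c}:G\times G\to\mathbb{C}$ is $\chi^{a,b,c}(\mathbf{x}_1,\mathbf{x}_2)=\mathrm{tr}_{V_c}\big(\pi^c_{a,b}\circ(\mathbf{x}_1^{\otimes a}\otimes\mathbf{x}_2^{\otimes b})\circ\iota^{a,b}_c\big)$. In the displayed relation, a (non-excluded) term whose index triple is not admissible has coefficient $0$ and is read as $0$. *)

theory Defs
  imports
    "HOL-Analysis.Analysis"
    "HOL-Combinatorics.Combinatorics"
    "HOL-Library.Function_Algebras"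
begin

definition SL2 :: "(complex^2^2) set" where
  "SL2 = {x. det x = 1}"

section \<open>Tensor powers of the plane\<close>

text \<open>
  Let V be the plane \<^typ>\<open>complex^2\<close>. An element of the n-th tensor power of V is given by its
  coordinates in the basis of the pure tensors of standard basis vectors, indexed by words of
  length n over the two-element type \<^typ>\<open>2\<close>; it is extended by 0 to words of other lengths.
  The 0-th tensor power is the ground field, z being the tensor with value z at the empty word.
\<close>

type_synonym tensor = "2 list \<Rightarrow> complex"

definition words :: "nat \<Rightarrow> 2 list set" where
  "words n = {w. length w = n}"

definition tpow :: "nat \<Rightarrow> tensor set" where
  "tpow n = {T. \<forall>w. w \<notin> words n \<longrightarrow> T w = 0}"

definition scaleT :: "complex \<Rightarrow> tensor \<Rightarrow> tensor" where
  "scaleT z T = (\<lambda>w. z * T w)"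

interpretation tensor: vector_space scaleT
  by unfold_locales (auto simp: scaleT_def fun_eq_iff algebra_simps)

definition pure :: "(complex^2) list \<Rightarrow> tensor" where
  "pure vs = (\<lambda>w. if length w = length vs then \<Prod>i<length vs. (vs ! i) $ (w ! i) else 0)"

definition std_vec :: "2 \<Rightarrow> complex^2" where
  "std_vec i = axis i 1"

definition basis_tensor :: "2 list \<Rightarrow> tensor" where
  "basis_tensor w = pure (map std_vec w)"

text \<open>
  The linear map on the n-th tensor power sending each pure tensor of standard basis vectors to
  the value of \<open>\<phi>\<close> on the list of these vectors. It is only used for multilinear \<open>\<phi>\<close>, for which it
  sends every pure tensor of vectors \<open>vs\<close> to \<open>\<phi> vs\<close>.
\<close>

definition lin_ext :: "nat \<Rightarrow> ((complex^2) list \<Rightarrow> tensor) \<Rightarrow> tensor \<Rightarrow> tensor" where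
  "lin_ext n \<phi> T = (\<Sum>w\<in>words n. scaleT (T w) (\<phi> (map std_vec w)))"

definition tensor_prod :: "tensor \<Rightarrow> tensor \<Rightarrow> tensor" where
  "tensor_prod S T = (\<lambda>w. \<Sum>k\<le>length w. S (take k w) * T (drop k w))"

text \<open>
  \<open>tensor_map m n f g\<close> is the tensor product of linear maps f and g with domains the m-th and
  the n-th tensor power; \<open>whisker p q m f\<close> is f, with domain the m-th tensor power, tensored with
  the identities of the p-th power on the left and of the q-th power on the right.
\<close>

definition tensor_map ::
    "nat \<Rightarrow> nat \<Rightarrow> (tensor \<Rightarrow> tensor) \<Rightarrow> (tensor \<Rightarrow> tensor) \<Rightarrow> tensor \<Rightarrow> tensor" where
  "tensor_map m n f g T =
     (\<Sum>u\<in>words m. \<Sum>v\<in>words n.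
        scaleT (T (u @ v)) (tensor_prod (f (basis_tensor u)) (g (basis_tensor v))))"

definition whisker :: "nat \<Rightarrow> nat \<Rightarrow> nat \<Rightarrow> (tensor \<Rightarrow> tensor) \<Rightarrow> tensor \<Rightarrow> tensor" where
  "whisker p q m f = tensor_map p (m + q) id (tensor_map m q f id)"

definition tpow_map :: "nat \<Rightarrow> complex^2^2 \<Rightarrow> tensor \<Rightarrow> tensor" where
  "tpow_map n x = lin_ext n (\<lambda>vs. pure (map (\<lambda>v. x *v v) vs))"

definition symmetrizer :: "nat \<Rightarrow> tensor \<Rightarrow> tensor" where
  "symmetrizer n = lin_ext n (\<lambda>vs.
     scaleT (1 / fact n) (\<Sum>\<sigma> | \<sigma> permutes {..<n}. pure (permute_list \<sigma> vs)))"

definition sympow :: "nat \<Rightarrow> tensor set" where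
  "sympow n = symmetrizer n ` tpow n"

section \<open>Cups and caps\<close>

definition cup1 :: "tensor \<Rightarrow> tensor" where
  "cup1 = lin_ext 0 (\<lambda>_. pure [std_vec 1, std_vec 2] - pure [std_vec 2, std_vec 1])"

text \<open>The pairing is the determinant of the matrix with columns v and w; 
  \<open>pure []\<close> is the scalar 1.\<close>

definition cap1 :: "tensor \<Rightarrow> tensor" where
  "cap1 = lin_ext 2 (\<lambda>vs.
     scaleT (det (\<chi> i j. if j = 1 then (vs ! 0) $ i else (vs ! 1) $ i)) (pure []))"

primrec cup :: "nat \<Rightarrow> tensor \<Rightarrow> tensor" where
  "cup 0 = id"
| "cup (Suc n) = whisker n n 0 cup1 \<circ> cup n"

primrec cap :: "nat \<Rightarrow> tensor \<Rightarrow> tensor" where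
  "cap 0 = id"
| "cap (Suc n) = cap n \<circ> whisker n n 2 cap1"

section \<open>Central functions\<close>

definition admissible :: "nat \<Rightarrow> nat \<Rightarrow> nat \<Rightarrow> bool" where
  "admissible a b c \<longleftrightarrow>
     (- real a + real b + real c) / 2 \<in> \<nat> \<and>
     (real a - real b + real c) / 2 \<in> \<nat> \<and>
     (real a + real b - real c) / 2 \<in> \<nat>"

text \<open>
  The following three numbers are only meaningful for admissible triples; the subtractions and
  divisions are then exact.
\<close>

definition adm_alpha :: "nat \<Rightarrow> nat \<Rightarrow> nat \<Rightarrow> nat" where
  "adm_alpha a b c = (b + c - a) div 2"

definition adm_beta :: "nat \<Rightarrow> nat \<Rightarrow> nat \<Rightarrow> nat" where
  "adm_beta a b c = (a + c - b) div 2"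

definition adm_gamma :: "nat \<Rightarrow> nat \<Rightarrow> nat \<Rightarrow> nat" where
  "adm_gamma a b c = (a + b - c) div 2"

text \<open>
  The maps \<open>iota\<close> and \<open>proj\<close> are given by formulas on whole tensor powers; only their values on
  \<open>sympow c\<close>, respectively on the tensor product of \<open>sympow a\<close> and \<open>sympow b\<close>, are used.
\<close>

definition iota :: "nat \<Rightarrow> nat \<Rightarrow> nat \<Rightarrow> tensor \<Rightarrow> tensor" where
  "iota a b c =
     tensor_map a b (symmetrizer a) (symmetrizer b) \<circ>
     whisker (adm_beta a b c) (adm_alpha a b c) 0 (cup (adm_gamma a b c))"

definition proj :: "nat \<Rightarrow> nat \<Rightarrow> nat \<Rightarrow> tensor \<Rightarrow> tensor" where
  "proj a b c =
     symmetrizer c \<circ>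
     whisker (adm_beta a b c) (adm_alpha a b c) (2 * adm_gamma a b c) (cap (adm_gamma a b c))"

text \<open>
  The trace of an endomorphism f of a finite-dimensional subspace U, computed in some basis of U;
  \<open>tensor.representation B v b\<close> is the coordinate of v at the basis vector b.
\<close>

definition trace_on :: "tensor set \<Rightarrow> (tensor \<Rightarrow> tensor) \<Rightarrow> complex" where
  "trace_on U f =
     (let B = (SOME B. tensor.independent B \<and> tensor.span B = U)
      in \<Sum>b\<in>B. tensor.representation B (f b) b)"

text \<open>For triples that are not admissible the value is 0 by convention.\<close>

definition central_fun :: "nat \<Rightarrow> nat \<Rightarrow> nat \<Rightarrow> complex^2^2 \<Rightarrow> complex^2^2 \<Rightarrow> complex" where
  "central_fun a b c x1 x2 =
     (if admissible a b c
      then trace_on (sympow c)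
             (proj a b c \<circ> tensor_map a b (tpow_map a x1) (tpow_map b x2) \<circ> iota a b c)
      else 0)"

end

theory Submission
  imports Defs "HOL-Library.Poly_Mapping"
begin

text \<open>
  Write \<open>x\<close> and \<open>y\<close> for the two group elements. The central function is the value of a theta
  network: two trivalent vertices joined by three edges that carry a, b and c symmetrized
  strands, with \<open>x\<close> inserted on the first edge and \<open>y\<close> on the second. At a vertex, \<open>\<alpha>\<close> strands
  join the edges b and c, \<open>\<beta>\<close> strands join a and c, and \<open>\<gamma>\<close> strands join a and b.

  Such a network is a pairing of polynomials. Give the edges a, b, c the vectors of variables u,
  v, s in the plane. A vertex is the product \<open>(u \<cdot> s)\<^sup>\<beta> (v \<cdot> s)\<^sup>\<alpha> [u, v]\<^sup>\<gamma>\<close>, where \<open>[u, v]\<close> is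
  the determinant; inserting the group elements replaces it by \<open>(xu \<cdot> s)\<^sup>\<beta> (yv \<cdot> s)\<^sup>\<alpha> [xu,
  yv]\<^sup>\<gamma>\<close>. Symmetrizing an edge and gluing its ends is the apolar pairing, in which
  multiplication by a variable is adjoint to the partial derivative: by Wick's theorem, the
  pairing of two products of linear forms is a permanent, which is what a symmetrizer between
  two bundles of strands contributes. So a! b! c! times the central function is the pairing
  \<open>theta\<close> of the second product with the first (\<open>central_fun_eq_theta\<close>). The linear algebra in
  this identification is the expression of the trace over the symmetric power as a sum over all
  words (\<open>trace_on_sympow\<close>).

  For \<open>theta\<close> the recurrence is a computation with adjoint operators (\<open>theta_recurrence\<close>). Take
  one factor \<open>u \<cdot> s\<close> of the first product to the other side of the pairing, where it acts as the
  second order operator \<open>\<Sum>\<^sub>i \<partial>/\<partial>u\<^sub>i \<partial>/\<partial>s\<^sub>i\<close>. By the Leibniz rule, the Cayley-Hamilton identity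
  \<open>x\<^sup>2 = tr(x) x - 1\<close> and the Pluecker relation between 2 by 2 determinants, the result is a
  combination of four terms (\<open>laplace_ac_vertex\<close>): one carries the factor \<open>tr(x)\<close>; one has a
  factor \<open>u \<cdot> s\<close> that can be taken back to the first product; in the other two, one factor \<open>[xu,
  yv]\<close> is replaced by \<open>[u, yv]\<close>, or one factor \<open>yv \<cdot> s\<close> by \<open>x\<^sup>-\<^sup>1yv \<cdot> s\<close>. These last two are
  evaluated by moving the end of a strand between the edges a and c with the rotations \<open>rot_ca\<close>
  and \<open>rot_ac\<close>, which are adjoint to each other (\<open>theta_split_alpha\<close>, \<open>theta_split_gamma\<close>); they
  give the networks with a or c lowered by two, and contribute to the one with both lowered.
  Dividing by the factorials yields the relation.
\<close>

section \<open>Polynomials with the apolar pairing\<close>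

type_synonym 'v cpoly = "('v \<Rightarrow>\<^sub>0 nat) \<Rightarrow>\<^sub>0 complex"

definition cst :: "complex \<Rightarrow> 'v cpoly" where
  "cst c = Poly_Mapping.single 0 c"

definition var :: "'v \<Rightarrow> 'v cpoly" where
  "var v = Poly_Mapping.single (Poly_Mapping.single v 1) 1"

text \<open>
  The square norm of a monomial for the apolar (or Fischer) pairing; this weight is what makes
  multiplication by a variable adjoint to the partial derivative.
\<close>

definition exp_fact :: "('v \<Rightarrow>\<^sub>0 nat) \<Rightarrow> complex" where
  "exp_fact m = (\<Prod>v\<in>Poly_Mapping.keys m. fact (Poly_Mapping.lookup m v))"

definition apolar :: "'v cpoly \<Rightarrow> 'v cpoly \<Rightarrow> complex" where
  "apolar p q = (\<Sum>m\<in>Poly_Mapping.keys p.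
     Poly_Mapping.lookup p m * Poly_Mapping.lookup q m * exp_fact m)"

definition pdiff :: "'v \<Rightarrow> 'v cpoly \<Rightarrow> 'v cpoly" where
  "pdiff v p = (\<Sum>m\<in>Poly_Mapping.keys p.
     Poly_Mapping.single (m - Poly_Mapping.single v 1)
       (of_nat (Poly_Mapping.lookup m v) * Poly_Mapping.lookup p m))"

lemma cpoly_induct [case_names single add]:
  fixes p :: "'v cpoly"
  assumes "\<And>m c. P (Poly_Mapping.single m c)" and "\<And>p q. P p \<Longrightarrow> P q \<Longrightarrow> P (p + q)"
  shows "P p"
proof (induction p rule: update_induct)
  case const
  show ?case using assms(1)[of 0 0] by simp
next
  case (update p m c)
  have "Poly_Mapping.update m c p = p + Poly_Mapping.single m c"
    using update(1) by (intro poly_mapping_eqI)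
      (auto simp: lookup_update lookup_add lookup_single in_keys_iff when_def)
  then show ?case using update(3) assms by simp
qed

lemma cst_0 [simp]: "cst 0 = 0" and cst_1 [simp]: "cst 1 = 1"
  and cst_add: "cst (a + b) = cst a + cst b" and cst_mult: "cst (a * b) = cst a * cst b"
  and cst_minus: "cst (- a) = - cst a" and cst_diff: "cst (a - b) = cst a - cst b"
  and cst_of_nat: "cst (of_nat n) = of_nat n"
  by (simp_all add: cst_def single_add mult_single single_uminus single_diff)

subsection \<open>The pairing\<close>

lemma apolar_superset:
  assumes "finite A" "Poly_Mapping.keys p \<subseteq> A"
  shows "apolar p q = (\<Sum>m\<in>A. Poly_Mapping.lookup p m * Poly_Mapping.lookup q m * exp_fact m)"
  unfolding apolar_def using assms by (intro sum.mono_neutral_left) (auto simp: in_keys_iff)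

lemma apolar_add_left: "apolar (p + q) r = apolar p r + apolar q r"
proof -
  let ?A = "Poly_Mapping.keys p \<union> Poly_Mapping.keys q"
  have "apolar (p + q) r = (\<Sum>m\<in>?A. Poly_Mapping.lookup (p + q) m * Poly_Mapping.lookup r m
      * exp_fact m)"
    by (intro apolar_superset) (simp_all add: keys_add)
  then show ?thesis
    by (subst (1 2) apolar_superset[of ?A]) (auto simp: lookup_add algebra_simps sum.distrib)
qed

lemma apolar_add_right: "apolar p (q + r) = apolar p q + apolar p r"
  by (simp add: apolar_def lookup_add algebra_simps sum.distrib)

lemma apolar_commute: "apolar p q = apolar q p"
proof -
  let ?A = "Poly_Mapping.keys p \<union> Poly_Mapping.keys q"
  show ?thesis
    by (subst (1 2) apolar_superset[of ?A]) (auto simp: algebra_simps)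
qed

lemma apolar_single:
  "apolar (Poly_Mapping.single m a) (Poly_Mapping.single n b) = (if m
      = n then a * b * exp_fact m else 0)"
  by (subst apolar_superset[of "{m}"]) (auto simp: lookup_single when_def)

lemma lookup_cst_mult: "Poly_Mapping.lookup (cst c * p) m = c * Poly_Mapping.lookup p m"
  unfolding cst_def mult_map_scale_conv_mult[symmetric]
  by (simp add: Poly_Mapping.map.rep_eq when_def)

lemma apolar_cst_right: "apolar p (cst c * q) = c * apolar p q"
  unfolding apolar_def lookup_cst_mult sum_distrib_left by (simp add: mult_ac)

lemma apolar_cst_left: "apolar (cst c * p) q = c * apolar p q"
  by (metis apolar_commute apolar_cst_right)

lemma apolar_0 [simp]: "apolar p 0 = 0" "apolar 0 p = 0"
  by (simp_all add: apolar_def)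

lemma apolar_sum_left: "apolar (\<Sum>i\<in>A. f i) q = (\<Sum>i\<in>A. apolar (f i) q)"
  by (induction A rule: infinite_finite_induct) (simp_all add: apolar_add_left)

lemma apolar_sum_right: "apolar p (\<Sum>i\<in>A. f i) = (\<Sum>i\<in>A. apolar p (f i))"
  by (induction A rule: infinite_finite_induct) (simp_all add: apolar_add_right)

lemma apolar_of_nat_right: "apolar p (of_nat n * q) = of_nat n * apolar p q"
  by (metis apolar_cst_right cst_of_nat)

lemma apolar_of_nat_left: "apolar (of_nat n * p) q = of_nat n * apolar p q"
  by (metis apolar_cst_left cst_of_nat)

lemma apolar_minus_right: "apolar p (- q) = - apolar p q"
  by (simp add: apolar_def sum_negf)

lemma apolar_diff_right: "apolar p (q - r) = apolar p q - apolar p r"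
  by (simp only: diff_conv_add_uminus apolar_add_right apolar_minus_right)

lemma apolar_diff_left: "apolar (p - q) r = apolar p r - apolar q r"
  by (metis apolar_commute apolar_diff_right)

lemma apolar_1: "apolar 1 1 = 1"
proof -
  have "apolar (Poly_Mapping.single 0 1) (Poly_Mapping.single 0 1) = 1"
    by (subst apolar_single) (simp add: exp_fact_def)
  then show ?thesis by simp
qed

subsection \<open>Partial derivatives\<close>

lemma pdiff_superset:
  assumes "finite A" "Poly_Mapping.keys p \<subseteq> A"
  shows "pdiff v p = (\<Sum>m\<in>A. Poly_Mapping.single (m - Poly_Mapping.single v 1)
       (of_nat (Poly_Mapping.lookup m v) * Poly_Mapping.lookup p m))"
  unfolding pdiff_def using assms by (intro sum.mono_neutral_left) (auto simp: in_keys_iff)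

lemma pdiff_add: "pdiff v (p + q) = pdiff v p + pdiff v q"
proof -
  let ?A = "Poly_Mapping.keys p \<union> Poly_Mapping.keys q"
  have "pdiff v (p + q) = (\<Sum>m\<in>?A. Poly_Mapping.single (m - Poly_Mapping.single v 1)
       (of_nat (Poly_Mapping.lookup m v) * Poly_Mapping.lookup (p + q) m))"
    by (intro pdiff_superset) (simp_all add: keys_add)
  then show ?thesis
    by (subst (1 2) pdiff_superset[of ?A]) (auto simp: lookup_add algebra_simps sum.distrib
        single_add)
qed

lemma pdiff_single: "pdiff v (Poly_Mapping.single m c) =
  Poly_Mapping.single (m - Poly_Mapping.single v 1) (of_nat (Poly_Mapping.lookup m v) * c)"
  by (subst pdiff_superset[of "{m}"]) auto

lemma pdiff_0 [simp]: "pdiff v 0 = 0"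
  by (simp add: pdiff_def)

lemma pdiff_minus: "pdiff v (- p) = - pdiff v p"
  using pdiff_add[of v p "- p"] by (simp add: eq_neg_iff_add_eq_0 add.commute)

lemma pdiff_diff: "pdiff v (p - q) = pdiff v p - pdiff v q"
  by (simp only: diff_conv_add_uminus pdiff_add pdiff_minus)

lemma pdiff_cst [simp]: "pdiff v (cst c) = 0"
  by (simp add: cst_def pdiff_single)

lemma pdiff_1 [simp]: "pdiff v 1 = 0"
  using pdiff_cst[of v 1] by simp

lemma pdiff_var: "pdiff v (var w) = (if v = w then 1 else 0)"
  by (auto simp: var_def pdiff_single lookup_single when_def)

lemma pdiff_mult_single:
  "pdiff v (Poly_Mapping.single m a * Poly_Mapping.single n b) =
     pdiff v (Poly_Mapping.single m a) * Poly_Mapping.single n b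
     + Poly_Mapping.single m a * pdiff v (Poly_Mapping.single n b)"
proof -
  let ?e = "Poly_Mapping.single v (1::nat)"
  have shift: "k - ?e + l = k + l - ?e" if "Poly_Mapping.lookup k v > 0" for k l :: "'a \<Rightarrow>\<^sub>0 nat"
    using that by (intro poly_mapping_eqI) (auto simp: lookup_add lookup_minus lookup_single
        when_def)
  have 1: "Poly_Mapping.single (m - ?e + n) (of_nat (Poly_Mapping.lookup m v) * a * b)
    = Poly_Mapping.single (m + n - ?e) (of_nat (Poly_Mapping.lookup m v) * a * b)"
    using shift[of m n] by (cases "Poly_Mapping.lookup m v = 0") auto
  have 2: "Poly_Mapping.single (m + (n - ?e)) (a * (of_nat (Poly_Mapping.lookup n v) * b))
    = Poly_Mapping.single (m + n - ?e) (a * (of_nat (Poly_Mapping.lookup n v) * b))"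
    using shift[of n m] by (cases "Poly_Mapping.lookup n v = 0") (auto simp: add.commute)
  show ?thesis
    unfolding mult_single pdiff_single 1 2
    by (simp add: lookup_add single_add[symmetric] algebra_simps)
qed

lemma pdiff_mult: "pdiff v (p * q) = pdiff v p * q + p * pdiff v q"
proof (induction p rule: cpoly_induct)
  case (single m c)
  show ?case
  proof (induction q rule: cpoly_induct)
    case (single n d)
    show ?case by (rule pdiff_mult_single)
  qed (simp add: algebra_simps pdiff_add)
qed (simp add: algebra_simps pdiff_add)

lemma pdiff_power: "pdiff v (p ^ n) = of_nat n * p ^ (n - 1) * pdiff v p"
proof (induction n)
  case (Suc n)
  then show ?case by (cases n) (simp_all add: pdiff_mult algebra_simps)
qed simp

lemma pdiff_prod:
  "finite S \<Longrightarrow> pdiff v (\<Prod>i\<in>S. f i) = (\<Sum>k\<in>S. pdiff v (f k) * (\<Prod>i\<in>S - {k}. f i))"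
proof (induction S rule: finite_induct)
  case (insert a S)
  have "(\<Sum>k\<in>S. pdiff v (f k) * (\<Prod>i\<in>insert a S - {k}. f i))
      = (\<Sum>k\<in>S. f a * (pdiff v (f k) * (\<Prod>i\<in>S - {k}. f i)))"
  proof (rule sum.cong)
    fix k assume "k \<in> S"
    then have "insert a S - {k} = insert a (S - {k})" using insert.hyps by auto
    then show "pdiff v (f k) * (\<Prod>i\<in>insert a S - {k}. f i)
      = f a * (pdiff v (f k) * (\<Prod>i\<in>S - {k}. f i))"
      using insert.hyps by (simp add: algebra_simps)
  qed simp
  with insert show ?case by (simp add: pdiff_mult sum_distrib_left)
qed simp

lemma exp_fact_add_single:
  "exp_fact (m + Poly_Mapping.single v 1) = of_nat (Suc (Poly_Mapping.lookup m v)) * exp_fact m"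
proof -
  let ?K = "insert v (Poly_Mapping.keys m)"
  have sup: "exp_fact k = (\<Prod>w\<in>?K. fact (Poly_Mapping.lookup k w))"
    if "Poly_Mapping.keys k \<subseteq> ?K" for k
    unfolding exp_fact_def using that by (intro prod.mono_neutral_left) (auto simp: in_keys_iff)
  have "Poly_Mapping.keys (m + Poly_Mapping.single v 1) \<subseteq> ?K"
    using keys_add[of m "Poly_Mapping.single v 1"] by (auto split: if_splits)
  then have "exp_fact (m + Poly_Mapping.single v 1)
    = fact (Suc (Poly_Mapping.lookup m v)) * (\<Prod>w\<in>?K - {v}. fact (Poly_Mapping.lookup m w))"
    by (subst sup, assumption, subst prod.remove[of ?K v])
      (auto simp: lookup_add lookup_single when_def eq_commute[of v] intro!: prod.cong)
  moreover have "exp_fact m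
    = fact (Poly_Mapping.lookup m v) * (\<Prod>w\<in>?K - {v}. fact (Poly_Mapping.lookup m w))"
    by (subst sup, blast, subst prod.remove[of ?K v]) auto
  ultimately show ?thesis by simp
qed

text \<open>
  By bilinearity it is enough to compare two monomials, where the claim is the recursion of the
  factorial.
\<close>

lemma apolar_var_mult: "apolar (var v * p) q = apolar p (pdiff v q)"
proof (induction p rule: cpoly_induct)
  case (single m a)
  show ?case
  proof (induction q rule: cpoly_induct)
    case (single n b)
    let ?e = "Poly_Mapping.single v (1::nat)"
    show ?case
    proof (cases "Poly_Mapping.lookup n v = 0")
      case True
      then have "?e + m \<noteq> n" by (auto simp: lookup_add)
      with True show ?thesis by (simp add: var_def mult_single pdiff_single apolar_single)
    next
      case False
      then have "n - ?e + ?e = n"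
        by (intro poly_mapping_eqI) (auto simp: lookup_add lookup_minus lookup_single when_def)
      then have iff: "?e + m = n \<longleftrightarrow> m = n - ?e" by (metis add.commute add_diff_cancel_right')
      show ?thesis
      proof (cases "m = n - ?e")
        case True
        then have "exp_fact n = of_nat (Poly_Mapping.lookup n v) * exp_fact m"
          using exp_fact_add_single[of m v] \<open>n - ?e + ?e = n\<close> False
          by (simp add: lookup_minus)
        moreover have "?e + m = n" using iff True by simp
        ultimately show ?thesis
          unfolding var_def mult_single pdiff_single apolar_single using True by simp
      next
        case False
        then show ?thesis
          unfolding var_def mult_single pdiff_single apolar_single iff by simp
      qed
    qed
  qed (simp add: algebra_simps pdiff_add apolar_add_right)
qed (simp add: algebra_simps apolar_add_left)

lemma pdiff_of_nat [simp]: "pdiff v (of_nat n) = 0"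
  by (metis pdiff_cst cst_of_nat)

lemma pdiff_commute: "pdiff v (pdiff w p) = pdiff w (pdiff v p)"
proof (induction p rule: cpoly_induct)
  case (single m c)
  have "m - Poly_Mapping.single v 1 - Poly_Mapping.single w 1
    = m - Poly_Mapping.single w 1 - (Poly_Mapping.single v 1 :: _ \<Rightarrow>\<^sub>0 nat)"
    by (intro poly_mapping_eqI) (simp add: lookup_minus)
  then show ?case
    by (cases "v = w") (simp_all add: pdiff_single lookup_minus lookup_single_not_eq mult_ac)
qed (simp add: pdiff_add)

section \<open>Strands, vertices and the theta network\<close>

datatype edge = EdgeA | EdgeB | EdgeC

text \<open>
  The i-th coordinate of \<open>x\<close> applied to the vector of the two variables of the edge \<open>e\<close>.
\<close>

definition gen :: "complex^2^2 \<Rightarrow> edge \<Rightarrow> 2 \<Rightarrow> (edge \<times> 2) cpoly" where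
  "gen x e i = (\<Sum>j\<in>UNIV. cst (x $ i $ j) * var (e, j))"

definition strand_ac :: "complex^2^2 \<Rightarrow> (edge \<times> 2) cpoly" where
  "strand_ac x = (\<Sum>i\<in>UNIV. gen x EdgeA i * gen (mat 1) EdgeC i)"

definition strand_bc :: "complex^2^2 \<Rightarrow> (edge \<times> 2) cpoly" where
  "strand_bc y = (\<Sum>i\<in>UNIV. gen y EdgeB i * gen (mat 1) EdgeC i)"

definition strand_ab :: "complex^2^2 \<Rightarrow> complex^2^2 \<Rightarrow> (edge \<times> 2) cpoly" where
  "strand_ab x y = gen x EdgeA 1 * gen y EdgeB 2 - gen x EdgeA 2 * gen y EdgeB 1"

text \<open>
  The vertex with group elements \<open>x\<close> and \<open>y\<close> on the edges a and b. The exponents follow the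
  usual names for an admissible triple: \<open>\<alpha>\<close> strands between b and c, \<open>\<beta>\<close> between a and c, \<open>\<gamma>\<close>
  between a and b.
\<close>

definition vertex ::
    "complex^2^2 \<Rightarrow> complex^2^2 \<Rightarrow> nat \<Rightarrow> nat \<Rightarrow> nat \<Rightarrow> (edge \<times> 2) cpoly" where
  "vertex x y \<alpha> \<beta> \<gamma> = strand_ac x ^ \<beta> * strand_bc y ^ \<alpha> * strand_ab x y ^ \<gamma>"

definition theta :: "complex^2^2 \<Rightarrow> complex^2^2 \<Rightarrow> nat \<Rightarrow> nat \<Rightarrow> nat \<Rightarrow> complex" where
  "theta x y \<alpha> \<beta> \<gamma> = apolar (vertex (mat 1) (mat 1) \<alpha> \<beta> \<gamma>) (vertex x y \<alpha> \<beta> \<gamma>)"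

lemma gen_one: "gen (mat 1) e i = var (e, i)"
proof -
  have "gen (mat 1) e i = (\<Sum>j\<in>UNIV. if j = i then var (e, j) else 0)"
    unfolding gen_def by (rule sum.cong) (auto simp: mat_def)
  then show ?thesis by simp
qed

text \<open>
  The adjoint of multiplication by the form joining the edges a and c.
\<close>

definition laplace_ac :: "(edge \<times> 2) cpoly \<Rightarrow> (edge \<times> 2) cpoly" where
  "laplace_ac p = (\<Sum>i\<in>UNIV. pdiff (EdgeA, i) (pdiff (EdgeC, i) p))"

lemma apolar_strand_ac_mult: "apolar (strand_ac (mat 1) * p) q = apolar p (laplace_ac q)"
  unfolding strand_ac_def laplace_ac_def gen_one sum_2
  by (simp add: distrib_right mult.assoc apolar_add_left apolar_add_right)
     (simp add: apolar_var_mult pdiff_commute[of "(EdgeC, _)" "(EdgeA, _)"])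

text \<open>
  Identify the plane with its dual by the determinant, so that \<open>v \<cdot> s = [s', v]\<close> for \<open>s' = (s\<^sub>2,
  -s\<^sub>1)\<close>. Then \<open>rot_ca\<close> is the derivation that replaces one u by \<open>s'\<close>, and \<open>rot_ac\<close> the one that
  replaces one \<open>s'\<close> by u. They move a strand end from one edge to the other.
\<close>

definition rot_ca :: "(edge \<times> 2) cpoly \<Rightarrow> (edge \<times> 2) cpoly" where
  "rot_ca p = var (EdgeC, 2) * pdiff (EdgeA, 1) p - var (EdgeC, 1) * pdiff (EdgeA, 2) p"

definition rot_ac :: "(edge \<times> 2) cpoly \<Rightarrow> (edge \<times> 2) cpoly" where
  "rot_ac p = var (EdgeA, 1) * pdiff (EdgeC, 2) p - var (EdgeA, 2) * pdiff (EdgeC, 1) p"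

lemma apolar_rot_ca: "apolar (rot_ca p) q = apolar p (rot_ac q)"
  unfolding rot_ca_def rot_ac_def
  by (simp add: apolar_diff_left apolar_diff_right apolar_var_mult)
     (metis apolar_commute apolar_var_mult)

lemma apolar_rot_ac: "apolar (rot_ac p) q = apolar p (rot_ca q)"
  by (metis apolar_commute apolar_rot_ca)

text \<open>
  By the description of \<open>rot_ca\<close> this is \<open>[xs', yv]\<close>, which for det x = 1 equals \<open>s \<cdot> x\<^sup>-\<^sup>1 y
  v\<close>: the strand joining b and c, with \<open>x\<^sup>-\<^sup>1\<close> inserted.
\<close>

definition twist_bc :: "complex^2^2 \<Rightarrow> complex^2^2 \<Rightarrow> (edge \<times> 2) cpoly" where
  "twist_bc x y = rot_ca (strand_ab x y)"

lemmas pdiff_simps = pdiff_add pdiff_diff pdiff_mult pdiff_var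

lemma pdiff_gen: "pdiff (e, j) (gen x f i) = (if e = f then cst (x $ i $ j) else 0)"
  using exhaust_2[of j] by (auto simp: gen_def sum_2 pdiff_simps)

lemma pdiff_strands:
  "pdiff (EdgeC, i) (strand_ac x) = gen x EdgeA i"
  "pdiff (EdgeC, i) (strand_bc y) = gen y EdgeB i"
  "pdiff (EdgeC, i) (strand_ab x y) = 0"
  "pdiff (EdgeA, i) (strand_ac x) = cst (x $ 1 $ i) * var (EdgeC, 1) + cst (x $ 2 $ i) * var
      (EdgeC, 2)"
  "pdiff (EdgeA, i) (strand_bc y) = 0"
  "pdiff (EdgeA, i) (strand_ab x y) = cst (x $ 1 $ i) * gen y EdgeB 2 - cst (x $ 2 $ i)
      * gen y EdgeB 1"
  using exhaust_2[of i]
  by (auto simp: strand_ac_def strand_bc_def strand_ab_def sum_2 pdiff_simps pdiff_gen gen_one)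

lemma cst_det:
  fixes x :: "complex^2^2"
  shows "det x = 1 \<Longrightarrow> cst (x $ 1 $ 1) * cst (x $ 2 $ 2) - cst (x $ 1 $ 2) * cst (x $ 2 $ 1) = 1"
  by (metis cst_1 cst_diff cst_mult det_2)

lemmas expand_derivs = twist_bc_def rot_ca_def rot_ac_def pdiff_strands

lemmas expand_strands = strand_bc_def strand_ac_def strand_ab_def gen_one

subsection \<open>Contractions of two strands\<close>

text \<open>
  The operator \<open>laplace_ac\<close> joins two strand ends. When one or both of its derivatives fall on
  \<open>strand_ac x\<close>, which carries \<open>x\<close>, the joined strand can carry \<open>x\<^sup>2\<close>, and the Cayley-Hamilton
  identity, in the form \<open>x\<^sup>2 = tr(x) x - det(x)\<close> or \<open>x = tr(x) - adj(x)\<close>, removes one \<open>x\<close>. Each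
  identity holds for every matrix once \<open>det x\<close> is put in the right place, and is proved by
  expanding it in that form.
\<close>

lemma contract_ac_ac:
  assumes "det x = 1"
  shows "(\<Sum>i\<in>UNIV. pdiff (EdgeA, i) (strand_ac x) * gen x EdgeA i)
    = cst (trace x) * strand_ac x - strand_ac (mat 1)"
proof -
  have "(\<Sum>i\<in>UNIV. pdiff (EdgeA, i) (strand_ac x) * gen x EdgeA i) = cst (trace x) * strand_ac x
      - (cst (x $ 1 $ 1) * cst (x $ 2 $ 2) - cst (x $ 1 $ 2) * cst (x $ 2 $ 1)) * strand_ac (mat 1)"
    unfolding expand_derivs unfolding expand_strands unfolding gen_def sum_2 trace_def cst_add
        by (simp add: algebra_simps)
  then show ?thesis unfolding cst_det[OF assms] by simp
qed

lemma contract_ab_ac: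
  assumes "det x = 1"
  shows "(\<Sum>i\<in>UNIV. pdiff (EdgeA, i) (strand_ab x y) * gen x EdgeA i)
    = cst (trace x) * strand_ab x y - strand_ab (mat 1) y"
proof -
  have "(\<Sum>i\<in>UNIV. pdiff (EdgeA, i) (strand_ab x y) * gen x EdgeA i) = cst (trace x) * strand_ab x y
      - (cst (x $ 1 $ 1) * cst (x $ 2 $ 2) - cst (x $ 1 $ 2) * cst (x $ 2 $ 1)) * strand_ab
          (mat 1) y"
    unfolding expand_derivs unfolding expand_strands unfolding gen_def sum_2 trace_def cst_add
        by (simp add: algebra_simps)
  then show ?thesis unfolding cst_det[OF assms] by simp
qed

lemma contract_ac_bc:
  "(\<Sum>i\<in>UNIV. pdiff (EdgeA, i) (strand_ac x) * gen y EdgeB i)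
    = cst (trace x) * strand_bc y - twist_bc x y"
  unfolding expand_derivs unfolding expand_strands unfolding sum_2 trace_def cst_add
      by (simp add: algebra_simps)

text \<open>
  Here the joined strand is \<open>[xyv, yv]\<close>, with both ends on the edge b. It is not a multiple of
  strands, but its product with \<open>xu \<cdot> s\<close> is, by the Pluecker relation and \<open>[xu, xyv] = det(x)
  [u, yv]\<close>.
\<close>

lemma contract_ab_bc:
  assumes "det x = 1"
  shows "strand_ac x * (\<Sum>i\<in>UNIV. pdiff (EdgeA, i) (strand_ab x y) * gen y EdgeB i)
    = (cst (trace x) * strand_bc y - twist_bc x y) * strand_ab x y - strand_bc y * strand_ab
        (mat 1) y"
proof -
  have "strand_ac x * (\<Sum>i\<in>UNIV. pdiff (EdgeA, i) (strand_ab x y) * gen y EdgeB i)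
    = (cst (trace x) * strand_bc y - twist_bc x y) * strand_ab x y
      - (cst (x $ 1 $ 1) * cst (x $ 2 $ 2) - cst (x $ 1 $ 2) * cst (x $ 2 $ 1))
          * (strand_bc y * strand_ab (mat 1) y)"
    unfolding expand_derivs unfolding expand_strands
        unfolding gen_def[of x] sum_2 trace_def cst_add by (simp add: algebra_simps)
  then show ?thesis unfolding cst_det[OF assms] by simp
qed

text \<open>
  Rotating \<open>xu \<cdot> s\<close> gives \<open>xs' \<cdot> s\<close>, with both ends on the edge c; again the Pluecker relation
  expresses its product with a strand by strands.
\<close>

lemma rot_ca_strand_ac_mult:
  assumes "det x = 1"
  shows "rot_ca (strand_ac x) * strand_ab x y = twist_bc x y * strand_ac x - strand_ac (mat 1)
      * strand_bc y"
proof -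
  have "rot_ca (strand_ac x) * strand_ab x y = twist_bc x y * strand_ac x
      - (cst (x $ 1 $ 1) * cst (x $ 2 $ 2) - cst (x $ 1 $ 2) * cst (x $ 2 $ 1))
          * (strand_ac (mat 1) * strand_bc y)"
    unfolding expand_derivs unfolding expand_strands unfolding gen_def[of x] sum_2
        by (simp add: algebra_simps)
  then show ?thesis unfolding cst_det[OF assms] by simp
qed

lemma rot_ac_strand_bc: "rot_ac (strand_bc y) = strand_ab (mat 1) y"
  unfolding rot_ac_def pdiff_strands strand_ab_def gen_one ..

lemma rot_ac_strand_ac_mult:
  "rot_ac (strand_ac x) * strand_bc y = strand_ab (mat 1) y * strand_ac x - strand_ac (mat 1)
      * strand_ab x y"
  unfolding expand_derivs unfolding expand_strands unfolding sum_2 by (simp add: algebra_simps)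

lemma mat_one_entry: "(mat 1 :: complex^2^2) $ i $ j = (if i = j then 1 else 0)"
  by (simp add: mat_def)

lemma rot_strands_one:
  "rot_ca (strand_bc y) = 0" "rot_ac (strand_ab x y) = 0"
  "rot_ca (strand_ac (mat 1)) = 0" "rot_ca (strand_ab (mat 1) (mat 1)) = strand_bc (mat 1)"
  "rot_ac (strand_ac (mat 1)) = 0" "rot_ac (strand_bc (mat 1)) = strand_ab (mat 1) (mat 1)"
  unfolding rot_ca_def rot_ac_def pdiff_strands gen_one
  by (simp_all add: mat_one_entry strand_bc_def strand_ab_def sum_2 gen_one algebra_simps)

subsection \<open>Differentiating a vertex\<close>

lemma rot_ca_mult: "rot_ca (p * q) = rot_ca p * q + p * rot_ca q"
  by (simp add: rot_ca_def pdiff_mult algebra_simps)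

lemma rot_ac_mult: "rot_ac (p * q) = rot_ac p * q + p * rot_ac q"
  by (simp add: rot_ac_def pdiff_mult algebra_simps)

lemma rot_ca_power: "rot_ca (p ^ n) = of_nat n * p ^ (n - 1) * rot_ca p"
  by (simp add: rot_ca_def pdiff_power algebra_simps)

lemma rot_ac_power: "rot_ac (p ^ n) = of_nat n * p ^ (n - 1) * rot_ac p"
  by (simp add: rot_ac_def pdiff_power algebra_simps)

text \<open>
  This form of the exponent shift holds for n = 0 too, which spares a case distinction in each
  use of the power rule.
\<close>

lemma of_nat_power_pred: "of_nat n * p ^ (n - 1) * p = of_nat n * (p ^ n :: 'a :: comm_semiring_1)"
  by (cases n) (simp_all add: mult_ac)

text \<open>
  In \<open>\<Sum>\<^sub>i \<partial>/\<partial>u\<^sub>i \<partial>/\<partial>s\<^sub>i\<close>, the derivative by s falls on \<open>xu \<cdot> s\<close> or \<open>yv \<cdot> s\<close>, the derivative by u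
  on \<open>xu \<cdot> s\<close> or \<open>[xu, yv]\<close>. The four combinations are the four contractions above; besides,
  both derivatives can fall on the same factor \<open>xu \<cdot> s\<close>, which gives \<open>tr(x)\<close>. The terms with the
  trace add up to the product of \<open>\<beta> + 1 + \<gamma> = a\<close> and \<open>\<beta> + 1 + \<alpha> = c\<close>.
\<close>

lemma laplace_ac_vertex:
  assumes "det x = 1"
  shows "laplace_ac (vertex x y \<alpha> (Suc \<beta>) \<gamma>)
    = of_nat (\<beta> + 1 + \<gamma>) * (of_nat (\<beta> + 1 + \<alpha>) * (cst (trace x) * vertex x y \<alpha> \<beta> \<gamma>))
      - of_nat (\<beta> + 1) * (of_nat \<beta> * (strand_ac (mat 1) * vertex x y \<alpha> (\<beta> - 1) \<gamma>))
      - of_nat (\<beta> + 1 + \<alpha>) * (of_nat \<gamma> * (strand_ab (mat 1) y * vertex x y \<alpha> \<beta> (\<gamma> - 1)))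
      - of_nat (\<beta> + 1 + \<gamma>) * (of_nat \<alpha> * (twist_bc x y * vertex x y (\<alpha> - 1) \<beta> \<gamma>))"
proof -
  define R1 R2 R3 where "R1 = strand_ac x" and "R2 = strand_bc y" and "R3 = strand_ab x y"
  define M1 M2 M3 where "M1 = R1 ^ \<beta>" and "M2 = R2 ^ \<alpha>" and "M3 = R3 ^ \<gamma>"
  \<comment> \<open>\<open>Lj\<close> is the derivative of \<open>Mj\<close> with respect to \<open>Rj\<close>; by \<open>L\<close>, it absorbs a factor \<open>Rj\<close>.\<close>
  define L1 L2 L3 where "L1 = of_nat \<beta> * R1 ^ (\<beta> - 1)" and "L2 = of_nat \<alpha> * R2 ^ (\<alpha> - 1)"
    and "L3 = of_nat \<gamma> * R3 ^ (\<gamma> - 1)"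
  define X Y Z W where "X = gen x EdgeA" and "Y = gen y EdgeB"
    and "Z = (\<lambda>i. pdiff (EdgeA, i) R1)" and "W = (\<lambda>i. pdiff (EdgeA, i) R3)"
  define b :: "(edge \<times> 2) cpoly" where "b = of_nat (Suc \<beta>)"
  have L: "L1 * R1 = of_nat \<beta> * M1" "L2 * R2 = of_nat \<alpha> * M2" "L3 * R3 = of_nat \<gamma> * M3"
    unfolding L1_def L2_def L3_def M1_def M2_def M3_def by (rule of_nat_power_pred)+
  have D: "pdiff (EdgeC, i) R1 = X i" "pdiff (EdgeC, i) R2 = Y i" "pdiff (EdgeC, i) R3 = 0"
     "pdiff (EdgeA, i) R1 = Z i" "pdiff (EdgeA, i) R2 = 0" "pdiff (EdgeA, i) R3 = W i"
     "pdiff (EdgeA, i) (Y i) = 0" "pdiff (EdgeA, i) (X i) = cst (x $ i $ i)" for i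
    by (simp_all add: R1_def R2_def R3_def X_def Y_def Z_def W_def pdiff_strands pdiff_gen)
  have dC: "pdiff (EdgeC, i) (R1 ^ Suc \<beta> * M2 * M3)
      = b * (M1 * X i * M2 * M3) + M1 * R1 * L2 * Y i * M3" for i
  proof -
    have "pdiff (EdgeC, i) (R1 ^ Suc \<beta>) = b * M1 * X i" "pdiff (EdgeC, i) M2 = L2 * Y i"
      "pdiff (EdgeC, i) M3 = 0"
      unfolding M1_def M2_def M3_def L2_def b_def
      by (simp_all only: pdiff_power D diff_Suc_1 mult_zero_right)
    moreover have "R1 ^ Suc \<beta> = R1 * M1"
      unfolding M1_def by simp
    ultimately show ?thesis
      by (simp only: pdiff_mult) (simp add: algebra_simps)
  qed
  have dM: "pdiff (EdgeA, i) M1 = L1 * Z i" "pdiff (EdgeA, i) M2 = 0" "pdiff (EdgeA, i) M3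
      = L3 * W i"
    "pdiff (EdgeA, i) L2 = 0" "pdiff (EdgeA, i) b = 0" for i
    unfolding M1_def M2_def M3_def L1_def L2_def L3_def b_def
    by (simp_all only: pdiff_mult pdiff_power D pdiff_of_nat mult_zero_left mult_zero_right add_0)
  have dAC: "pdiff (EdgeA, i) (pdiff (EdgeC, i) (R1 ^ Suc \<beta> * M2 * M3))
     = b * L1 * M2 * M3 * (Z i * X i) + b * M1 * M2 * M3 * cst (x $ i $ i)
       + b * M1 * M2 * L3 * (W i * X i) + (L1 * R1 + M1) * L2 * M3 * (Z i * Y i)
       + M1 * L2 * L3 * (R1 * (W i * Y i))" for i
    unfolding dC by (simp add: pdiff_add pdiff_mult dM D algebra_simps)
  have "laplace_ac (R1 ^ Suc \<beta> * M2 * M3)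
     = b * L1 * M2 * M3 * (\<Sum>i\<in>UNIV. Z i * X i) + b * M1 * M2 * M3 * (\<Sum>i\<in>UNIV. cst (x $ i $ i))
       + b * M1 * M2 * L3 * (\<Sum>i\<in>UNIV. W i * X i) + (L1 * R1 + M1) * L2 * M3 * (\<Sum>i\<in>UNIV. Z i * Y i)
       + M1 * L2 * L3 * (R1 * (\<Sum>i\<in>UNIV. W i * Y i))"
    unfolding laplace_ac_def dAC sum_2 by (simp add: algebra_simps)
  also have "(\<Sum>i\<in>UNIV. cst (x $ i $ i)) = cst (trace x)"
    by (simp add: trace_def sum_2 cst_add)
  also have "(\<Sum>i\<in>UNIV. Z i * X i) = cst (trace x) * R1 - strand_ac (mat 1)"
    unfolding Z_def X_def R1_def by (rule contract_ac_ac[OF assms])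
  also have "(\<Sum>i\<in>UNIV. W i * X i) = cst (trace x) * R3 - strand_ab (mat 1) y"
    unfolding W_def X_def R3_def by (rule contract_ab_ac[OF assms])
  also have "(\<Sum>i\<in>UNIV. Z i * Y i) = cst (trace x) * R2 - twist_bc x y"
    unfolding Z_def Y_def R1_def R2_def by (rule contract_ac_bc)
  also have "R1 * (\<Sum>i\<in>UNIV. W i * Y i)
      = (cst (trace x) * R2 - twist_bc x y) * R3 - R2 * strand_ab (mat 1) y"
    unfolding W_def Y_def R1_def R2_def R3_def by (rule contract_ab_bc[OF assms])
  finally have main: "laplace_ac (R1 ^ Suc \<beta> * M2 * M3) =
     b * (L1 * R1) * M2 * M3 * cst (trace x) - b * L1 * M2 * M3 * strand_ac (mat 1)
     + b * M1 * M2 * M3 * cst (trace x)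
     + b * M1 * M2 * (L3 * R3) * cst (trace x) - b * M1 * M2 * L3 * strand_ab (mat 1) y
     + (L1 * R1 + M1) * (L2 * R2) * M3 * cst (trace x) - (L1 * R1 + M1) * L2 * M3 * twist_bc x y
     + M1 * (L2 * R2) * (L3 * R3) * cst (trace x) - M1 * L2 * (L3 * R3) * twist_bc x y
     - M1 * (L2 * R2) * L3 * strand_ab (mat 1) y"
    by (simp add: algebra_simps)
  have "laplace_ac (R1 ^ Suc \<beta> * M2 * M3) =
      of_nat (\<beta> + 1 + \<gamma>) * (of_nat (\<beta> + 1 + \<alpha>) * (cst (trace x) * (M1 * M2 * M3)))
      - of_nat (\<beta> + 1) * (strand_ac (mat 1) * (L1 * M2 * M3))
      - of_nat (\<beta> + 1 + \<alpha>) * (strand_ab (mat 1) y * (M1 * M2 * L3))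
      - of_nat (\<beta> + 1 + \<gamma>) * (twist_bc x y * (M1 * L2 * M3))"
    unfolding main L b_def by (simp add: algebra_simps)
  then show ?thesis
    unfolding vertex_def R1_def[symmetric] R2_def[symmetric] R3_def[symmetric]
      M1_def[symmetric] M2_def[symmetric] M3_def[symmetric] L1_def L2_def L3_def
    by (simp only: mult_ac)
qed

lemma vertex_strand_ac: "strand_ac x * vertex x y \<alpha> \<beta> \<gamma> = vertex x y \<alpha> (Suc \<beta>) \<gamma>"
  by (simp add: vertex_def mult_ac)

lemma twist_bc_one: "twist_bc (mat 1) (mat 1) = strand_bc (mat 1)"
  by (simp add: twist_bc_def rot_strands_one)

subsection \<open>The recurrence for the theta network\<close>

text \<open>
  For trivial group elements all strands carry the identity, so the four terms of
  \<open>laplace_ac_vertex\<close> are multiples of the same vertex.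
\<close>

lemma laplace_ac_vertex_one:
  "laplace_ac (vertex (mat 1) (mat 1) \<alpha> (Suc \<beta>) \<gamma>)
    = of_nat ((\<beta> + 1) * (\<alpha> + \<beta> + \<gamma> + 2)) * vertex (mat 1) (mat 1) \<alpha> \<beta> \<gamma>"
proof -
  let ?V = "vertex (mat 1) (mat 1) :: _ \<Rightarrow> _ \<Rightarrow> _ \<Rightarrow> (edge \<times> 2) cpoly"
  have 1: "of_nat \<beta> * (strand_ac (mat 1) * ?V \<alpha> (\<beta> - 1) \<gamma>) = of_nat \<beta> * ?V \<alpha> \<beta> \<gamma>"
    by (cases \<beta>) (simp_all add: vertex_def mult_ac)
  have 2: "of_nat \<gamma> * (strand_ab (mat 1) (mat 1) * ?V \<alpha> \<beta> (\<gamma> - 1)) = of_nat \<gamma> * ?V \<alpha> \<beta> \<gamma>"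
    by (cases \<gamma>) (simp_all add: vertex_def mult_ac)
  have 3: "of_nat \<alpha> * (twist_bc (mat 1) (mat 1) * ?V (\<alpha> - 1) \<beta> \<gamma>) = of_nat \<alpha> * ?V \<alpha> \<beta> \<gamma>"
    by (cases \<alpha>) (simp_all add: vertex_def twist_bc_one mult_ac)
  have tr: "cst (trace (mat 1 :: complex^2^2)) = (2 :: (edge \<times> 2) cpoly)"
    by (simp add: trace_def sum_2 mat_one_entry) (metis cst_of_nat of_nat_numeral)
  show ?thesis
    unfolding laplace_ac_vertex[OF det_I] 1 2 3 tr by (simp add: algebra_simps)
qed

text \<open>
  Rotating the vertex without group elements by \<open>rot_ac\<close> trades one strand between b and c for
  one between a and b. By adjointness the pairing with the new vertex is the pairing of the old
  one with a rotated vertex, and \<open>rot_ca_strand_ac_mult\<close> expresses that by the twisted strand.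
\<close>

lemma theta_split_alpha:
  assumes "det x = 1" "\<alpha> > 0"
  shows "of_nat \<alpha> * theta x y (\<alpha> - 1) \<beta> (\<gamma> + 1)
    = of_nat (\<beta> + \<gamma> + 1) * apolar (vertex (mat 1) (mat 1) \<alpha> \<beta> \<gamma>) (twist_bc x y * vertex x y
        (\<alpha> - 1) \<beta> \<gamma>)
      - of_nat \<beta> * apolar (vertex (mat 1) (mat 1) \<alpha> \<beta> \<gamma>) (strand_ac (mat 1) * vertex x y \<alpha>
          (\<beta> - 1) \<gamma>)"
proof -
  let ?N = "vertex (mat 1) (mat 1) \<alpha> \<beta> \<gamma>"
  obtain a where a: "\<alpha> = Suc a" using assms gr0_conv_Suc by auto
  have "of_nat \<alpha> * vertex (mat 1) (mat 1) (\<alpha> - 1) \<beta> (\<gamma> + 1) = rot_ac ?N"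
    unfolding vertex_def rot_ac_mult rot_ac_power rot_strands_one a by (simp add: mult_ac)
  then have "of_nat \<alpha> * theta x y (\<alpha> - 1) \<beta> (\<gamma> + 1)
      = apolar ?N (rot_ca (vertex x y (\<alpha> - 1) \<beta> (\<gamma> + 1)))"
    unfolding theta_def apolar_of_nat_left[symmetric] by (simp only: apolar_rot_ac)
  also have "rot_ca (vertex x y (\<alpha> - 1) \<beta> (\<gamma> + 1))
     = of_nat \<beta> * strand_ac x ^ (\<beta> - 1) * strand_bc y ^ a * strand_ab x y ^ \<gamma>
         * (rot_ca (strand_ac x) * strand_ab x y)
       + of_nat (\<gamma> + 1) * (twist_bc x y * vertex x y (\<alpha> - 1) \<beta> \<gamma>)"
    unfolding vertex_def rot_ca_mult rot_ca_power rot_strands_one a twist_bc_def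
    by (simp add: algebra_simps)
  also have "of_nat \<beta> * strand_ac x ^ (\<beta> - 1) * strand_bc y ^ a * strand_ab x y ^ \<gamma>
      * (rot_ca (strand_ac x) * strand_ab x y)
     = (of_nat \<beta> * strand_ac x ^ (\<beta> - 1) * strand_ac x)
         * (twist_bc x y * strand_bc y ^ a * strand_ab x y ^ \<gamma>)
       - of_nat \<beta> * (strand_ac (mat 1) * vertex x y \<alpha> (\<beta> - 1) \<gamma>)"
    unfolding rot_ca_strand_ac_mult[OF assms(1)] vertex_def a by (simp add: algebra_simps)
  also have "(of_nat \<beta> * strand_ac x ^ (\<beta> - 1) * strand_ac x)
      * (twist_bc x y * strand_bc y ^ a * strand_ab x y ^ \<gamma>)
     = of_nat \<beta> * (twist_bc x y * vertex x y (\<alpha> - 1) \<beta> \<gamma>)"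
    unfolding of_nat_power_pred vertex_def a by (simp add: mult_ac)
  finally show ?thesis
    unfolding apolar_add_right apolar_diff_right apolar_of_nat_right by (simp add: algebra_simps)
qed

text \<open>
  The same exchange in the other direction.
\<close>

lemma theta_split_gamma:
  assumes "\<gamma> > 0"
  shows "of_nat \<gamma> * theta x y (\<alpha> + 1) \<beta> (\<gamma> - 1)
    = of_nat (\<beta> + \<alpha> + 1) * apolar (vertex (mat 1) (mat 1) \<alpha> \<beta> \<gamma>) (strand_ab (mat 1) y
        * vertex x y \<alpha> \<beta> (\<gamma> - 1))
      - of_nat \<beta> * apolar (vertex (mat 1) (mat 1) \<alpha> \<beta> \<gamma>) (strand_ac (mat 1) * vertex x y \<alpha>
          (\<beta> - 1) \<gamma>)"
proof -
  let ?N = "vertex (mat 1) (mat 1) \<alpha> \<beta> \<gamma>"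
  obtain g where g: "\<gamma> = Suc g" using assms gr0_conv_Suc by auto
  have "of_nat \<gamma> * vertex (mat 1) (mat 1) (\<alpha> + 1) \<beta> (\<gamma> - 1) = rot_ca ?N"
    unfolding vertex_def rot_ca_mult rot_ca_power rot_strands_one g by (simp add: mult_ac)
  then have "of_nat \<gamma> * theta x y (\<alpha> + 1) \<beta> (\<gamma> - 1)
      = apolar ?N (rot_ac (vertex x y (\<alpha> + 1) \<beta> (\<gamma> - 1)))"
    unfolding theta_def apolar_of_nat_left[symmetric] by (simp only: apolar_rot_ca)
  also have "rot_ac (vertex x y (\<alpha> + 1) \<beta> (\<gamma> - 1))
     = of_nat \<beta> * strand_ac x ^ (\<beta> - 1) * strand_bc y ^ \<alpha> * strand_ab x y ^ g
         * (rot_ac (strand_ac x) * strand_bc y)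
       + of_nat (\<alpha> + 1) * (strand_ab (mat 1) y * vertex x y \<alpha> \<beta> (\<gamma> - 1))"
    unfolding vertex_def rot_ac_mult rot_ac_power rot_strands_one g rot_ac_strand_bc
    by (simp add: algebra_simps)
  also have "of_nat \<beta> * strand_ac x ^ (\<beta> - 1) * strand_bc y ^ \<alpha> * strand_ab x y ^ g
      * (rot_ac (strand_ac x) * strand_bc y)
     = (of_nat \<beta> * strand_ac x ^ (\<beta> - 1) * strand_ac x)
         * (strand_ab (mat 1) y * strand_bc y ^ \<alpha> * strand_ab x y ^ g)
       - of_nat \<beta> * (strand_ac (mat 1) * vertex x y \<alpha> (\<beta> - 1) \<gamma>)"
    unfolding rot_ac_strand_ac_mult vertex_def g by (simp add: algebra_simps)
  also have "(of_nat \<beta> * strand_ac x ^ (\<beta> - 1) * strand_ac x)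
      * (strand_ab (mat 1) y * strand_bc y ^ \<alpha> * strand_ab x y ^ g)
     = of_nat \<beta> * (strand_ab (mat 1) y * vertex x y \<alpha> \<beta> (\<gamma> - 1))"
    unfolding of_nat_power_pred vertex_def g by (simp add: mult_ac)
  finally show ?thesis
    unfolding apolar_add_right apolar_diff_right apolar_of_nat_right by (simp add: algebra_simps)
qed

text \<open>
  The factor \<open>u \<cdot> s\<close> on the right acts on the left vertex as \<open>laplace_ac\<close>, which only changes it
  by a scalar and an exponent.
\<close>

lemma apolar_vertex_strand_ac:
  "of_nat \<beta> * apolar (vertex (mat 1) (mat 1) \<alpha> \<beta> \<gamma>) (strand_ac (mat 1) * vertex x y \<alpha> (\<beta> - 1) \<gamma>)
   = of_nat (\<beta>\<^sup>2 * (\<alpha> + \<beta> + \<gamma> + 1)) * theta x y \<alpha> (\<beta> - 1) \<gamma>"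
proof (cases \<beta>)
  case (Suc b)
  have "apolar (vertex (mat 1) (mat 1) \<alpha> \<beta> \<gamma>) (strand_ac (mat 1) * vertex x y \<alpha> b \<gamma>)
     = apolar (laplace_ac (vertex (mat 1) (mat 1) \<alpha> (Suc b) \<gamma>)) (vertex x y \<alpha> b \<gamma>)"
    by (metis Suc apolar_commute apolar_strand_ac_mult)
  also have "\<dots> = of_nat ((b + 1) * (\<alpha> + b + \<gamma> + 2)) * theta x y \<alpha> b \<gamma>"
    unfolding laplace_ac_vertex_one apolar_of_nat_left theta_def ..
  finally show ?thesis using Suc by (simp add: power2_eq_square algebra_simps)
qed simp

text \<open>
  The scalar of the last term collects three contributions: with \<open>n = \<alpha> + \<beta> + \<gamma> + 1\<close>, the term
  of \<open>laplace_ac_vertex\<close> that is taken back contributes \<open>(\<beta> + 1) \<beta>\<^sup>2 n\<close>, and the two rotations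
  contribute \<open>\<alpha> \<beta>\<^sup>2 n\<close> and \<open>\<gamma> \<beta>\<^sup>2 n\<close>.
\<close>

lemma theta_recurrence:
  assumes "det x = 1"
  shows "theta x y \<alpha> (Suc \<beta>) \<gamma> =
      of_nat ((\<beta> + \<gamma> + 1) * (\<beta> + \<alpha> + 1)) * trace x * theta x y \<alpha> \<beta> \<gamma>
      - of_nat (\<gamma>\<^sup>2) * theta x y (\<alpha> + 1) \<beta> (\<gamma> - 1)
      - of_nat (\<alpha>\<^sup>2) * theta x y (\<alpha> - 1) \<beta> (\<gamma> + 1)
      - of_nat (\<beta>\<^sup>2 * (\<alpha> + \<beta> + \<gamma> + 1)\<^sup>2) * theta x y \<alpha> (\<beta> - 1) \<gamma>"
proof -
  let ?N = "vertex (mat 1) (mat 1) \<alpha> \<beta> \<gamma>"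
  define P where "P = of_nat \<beta> * apolar ?N (strand_ac (mat 1) * vertex x y \<alpha> (\<beta> - 1) \<gamma>)"
  define S where "S = apolar ?N (twist_bc x y * vertex x y (\<alpha> - 1) \<beta> \<gamma>)"
  define T where "T = apolar ?N (strand_ab (mat 1) y * vertex x y \<alpha> \<beta> (\<gamma> - 1))"
  have P: "P = of_nat (\<beta>\<^sup>2 * (\<alpha> + \<beta> + \<gamma> + 1)) * theta x y \<alpha> (\<beta> - 1) \<gamma>"
    unfolding P_def by (rule apolar_vertex_strand_ac)
  have S: "of_nat \<alpha> * (of_nat (\<beta> + \<gamma> + 1) * S)
     = of_nat \<alpha> * (of_nat \<alpha> * theta x y (\<alpha> - 1) \<beta> (\<gamma> + 1) + P)"
    using theta_split_alpha[OF assms, of \<alpha> y \<beta> \<gamma>] by (cases \<alpha>) (simp_all add: S_def P_def)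
  have T: "of_nat \<gamma> * (of_nat (\<beta> + \<alpha> + 1) * T)
     = of_nat \<gamma> * (of_nat \<gamma> * theta x y (\<alpha> + 1) \<beta> (\<gamma> - 1) + P)"
    using theta_split_gamma[of \<gamma> x y \<alpha> \<beta>] by (cases \<gamma>) (simp_all add: T_def P_def)
  have "theta x y \<alpha> (Suc \<beta>) \<gamma> = apolar ?N (laplace_ac (vertex x y \<alpha> (Suc \<beta>) \<gamma>))"
    unfolding theta_def vertex_strand_ac[symmetric, of "mat 1"]
        by (simp only: apolar_strand_ac_mult)
  also have "\<dots> = of_nat (\<beta> + 1 + \<gamma>) * (of_nat (\<beta> + 1 + \<alpha>) * (trace x * theta x y \<alpha> \<beta> \<gamma>))
      - of_nat (\<beta> + 1) * P - of_nat (\<beta> + 1 + \<alpha>) * (of_nat \<gamma> * T)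
      - of_nat (\<beta> + 1 + \<gamma>) * (of_nat \<alpha> * S)"
    unfolding laplace_ac_vertex[OF assms] apolar_diff_right apolar_of_nat_right apolar_cst_right
      theta_def P_def S_def T_def ..
  also have "\<dots> = of_nat (\<beta> + 1 + \<gamma>) * (of_nat (\<beta> + 1 + \<alpha>) * (trace x * theta x y \<alpha> \<beta> \<gamma>))
      - of_nat (\<beta> + 1) * P - of_nat \<gamma> * (of_nat (\<beta> + \<alpha> + 1) * T)
      - of_nat \<alpha> * (of_nat (\<beta> + \<gamma> + 1) * S)"
    by (simp add: algebra_simps)
  finally show ?thesis
    unfolding S T P by (simp add: algebra_simps power2_eq_square)
qed

section \<open>Words and permanents\<close>

lemma in_words [simp]: "w \<in> words n \<longleftrightarrow> length w = n"
  by (simp add: words_def)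

lemma words_0 [simp]: "words 0 = {[]}"
  by (auto)

lemma finite_words [simp]: "finite (words n)"
  using finite_lists_length_eq[of "UNIV :: 2 set" n] by (simp add: words_def)

lemma sum_words_append:
  "(\<Sum>w\<in>words (m + n). F w) = (\<Sum>u\<in>words m. \<Sum>v\<in>words n. F (u @ v))"
  unfolding sum.cartesian_product
  by (rule sum.reindex_bij_witness[where i = "\<lambda>(u, v). u @ v" and j = "\<lambda>w. (take m w, drop m w)"])
     (auto)

lemma sum_words_1: "(\<Sum>w\<in>words (Suc 0). F w) = (\<Sum>i\<in>UNIV. F [i])"
  by (rule sum.reindex_bij_witness[where i = "\<lambda>i. [i]" and j = hd])
     (auto simp: length_Suc_conv)

lemma sum_words_Suc: "(\<Sum>w\<in>words (Suc n). F w) = (\<Sum>i\<in>UNIV. \<Sum>v\<in>words n. F (i # v))"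
  using sum_words_append[of F "Suc 0" n] by (simp add: sum_words_1)

lemma sum_words_snoc: "(\<Sum>w\<in>words (Suc n). F w) = (\<Sum>v\<in>words n. \<Sum>i\<in>UNIV. F (v @ [i]))"
  using sum_words_append[of F n "Suc 0"] by (simp add: sum_words_1)

lemma sum_words_rev: "(\<Sum>w\<in>words n. F (rev w)) = (\<Sum>w\<in>words n. F w)"
  by (rule sum.reindex_bij_witness[where i = rev and j = rev]) (auto)

lemma power_sum_words:
  fixes f :: "2 \<Rightarrow> 'a :: comm_semiring_1"
  shows "(\<Sum>i\<in>UNIV. f i) ^ n = (\<Sum>w\<in>words n. prod_list (map f w))"
proof (induction n)
  case (Suc n)
  then show ?case by (simp add: sum_words_Suc sum_product)
qed simp

lemma power_sum_words2:
  fixes f :: "2 \<Rightarrow> 2 \<Rightarrow> 'a :: comm_semiring_1"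
  shows "(\<Sum>i\<in>UNIV. \<Sum>j\<in>UNIV. f i j) ^ n
    = (\<Sum>g\<in>words n. \<Sum>h\<in>words n. prod_list (map2 f g h))"
proof (induction n)
  case (Suc n)
  have "(\<Sum>i\<in>UNIV. \<Sum>j\<in>UNIV. f i j) ^ Suc n
    = (\<Sum>i\<in>UNIV. \<Sum>g\<in>words n. (\<Sum>j\<in>UNIV. f i j) * (\<Sum>h\<in>words n. prod_list (map2 f g h)))"
    by (simp only: power_Suc Suc sum_product)
  then show ?case by (simp only: sum_words_Suc sum_product) simp
qed simp

text \<open>
  The permanent of the square matrix with entries \<open>x $ (w ! k) $ (u ! l)\<close>.
\<close>

definition permanent :: "complex^2^2 \<Rightarrow> 2 list \<Rightarrow> 2 list \<Rightarrow> complex" where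
  "permanent x w u =
     (\<Sum>\<sigma> | \<sigma> permutes {..<length u}. \<Prod>k<length u. x $ (w ! \<sigma> k) $ (u ! k))"

lemma permanent_inverse:
  "permanent x w u =
     (\<Sum>\<sigma> | \<sigma> permutes {..<length u}. \<Prod>k<length u. x $ (w ! k) $ (u ! \<sigma> k))"
proof -
  have "permanent x w u = (\<Sum>\<sigma> | \<sigma> permutes {..<length u}.
      \<Prod>k<length u. x $ (w ! inv \<sigma> k) $ (u ! k))"
    unfolding permanent_def
    by (rule sum_permutations_inverse)
  also have "\<dots> = (\<Sum>\<sigma> | \<sigma> permutes {..<length u}. \<Prod>k<length u. x $ (w ! k) $ (u ! \<sigma> k))"
  proof (rule sum.cong)
    fix \<sigma> assume "\<sigma> \<in> {\<sigma>. \<sigma> permutes {..<length u}}"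
    then have \<sigma>: "\<sigma> permutes {..<length u}" by simp
    show "(\<Prod>k<length u. x $ (w ! inv \<sigma> k) $ (u ! k)) = (\<Prod>k<length u. x $ (w ! k) $ (u ! \<sigma> k))"
      by (subst prod.permute[OF \<sigma>]) (simp add: o_def permutes_inverses[OF \<sigma>])
  qed simp
  finally show ?thesis .
qed

lemma permanent_one_commute:
  assumes "length u = length w"
  shows "permanent (mat 1) w u = permanent (mat 1) u w"
  by (subst permanent_inverse) (simp add: permanent_def mat_one_entry assms eq_commute)

lemma permanent_eq_sum_permute_list:
  assumes "w \<in> words n" "u \<in> words n"
  shows "(\<Sum>\<sigma> | \<sigma> permutes {..<n}. if w = permute_list \<sigma> u then 1 else 0) = permanent (mat 1) w u"
  unfolding permanent_inverse
proof (rule sum.cong)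
  fix \<sigma> assume "\<sigma> \<in> {\<sigma>. \<sigma> permutes {..<length u}}"
  then have \<sigma>: "\<sigma> permutes {..<length u}" by simp
  have "w = permute_list \<sigma> u \<longleftrightarrow> (\<forall>k<length u. w ! k = u ! \<sigma> k)"
    using assms by (simp add: list_eq_iff_nth_eq permute_list_nth[OF \<sigma>])
  then show "(if w = permute_list \<sigma> u then 1 else 0)
      = (\<Prod>k<length u. (mat 1 :: complex^2^2) $ (w ! k) $ (u ! \<sigma> k))"
    by (auto simp: mat_one_entry)
qed (use assms in simp)

text \<open>
  For x = 1 the permanent counts the rearrangements of \<open>u\<close> into \<open>w\<close>, so the sum over \<open>w\<close> becomes
  a sum over permutations.
\<close>

lemma permanent_collapse:
  assumes "z \<in> words n" "u \<in> words n"
  shows "(\<Sum>w\<in>words n. (\<Prod>k<n. x $ (z ! k) $ (w ! k)) * permanent (mat 1) w u) = permanent x z u"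
proof -
  have "(\<Sum>w\<in>words n. (\<Prod>k<n. x $ (z ! k) $ (w ! k)) * permanent (mat 1) w u)
     = (\<Sum>w\<in>words n. \<Sum>\<sigma> | \<sigma> permutes {..<n}.
         if w = permute_list \<sigma> u then \<Prod>k<n. x $ (z ! k) $ (w ! k) else 0)"
  proof (intro sum.cong refl)
    fix w assume "w \<in> words n"
    then have "permanent (mat 1) w u
        = (\<Sum>\<sigma> | \<sigma> permutes {..<n}. if w = permute_list \<sigma> u then 1 else 0)"
      using permanent_eq_sum_permute_list[of w n u] assms(2) by simp
    then show "(\<Prod>k<n. x $ (z ! k) $ (w ! k)) * permanent (mat 1) w u
      = (\<Sum>\<sigma> | \<sigma> permutes {..<n}. if w = permute_list \<sigma> u then \<Prod>k<n. x $ (z ! k) $ (w ! k) else 0)"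
      by (simp only: sum_distrib_left) (intro sum.cong, simp_all)
  qed
  also have "\<dots> = (\<Sum>\<sigma> | \<sigma> permutes {..<n}. \<Sum>w\<in>words n.
         if w = permute_list \<sigma> u then \<Prod>k<n. x $ (z ! k) $ (w ! k) else 0)"
    by (rule sum.swap)
  also have "\<dots> = (\<Sum>\<sigma> | \<sigma> permutes {..<n}. \<Prod>k<n. x $ (z ! k) $ (u ! \<sigma> k))"
  proof (rule sum.cong)
    fix \<sigma> assume "\<sigma> \<in> {\<sigma>. \<sigma> permutes {..<n}}"
    then have \<sigma>: "\<sigma> permutes {..<length u}" using assms by simp
    have "permute_list \<sigma> u \<in> words n" using assms by simp
    then show "(\<Sum>w\<in>words n. if w = permute_list \<sigma> u then \<Prod>k<n. x $ (z ! k) $ (w ! k) else 0)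
        = (\<Prod>k<n. x $ (z ! k) $ (u ! \<sigma> k))"
      using assms by (simp add: permute_list_nth[OF \<sigma>])
  qed simp
  finally show ?thesis using assms by (simp add: permanent_inverse)
qed

section \<open>Expansion of the theta network in permanents\<close>

text \<open>
  Wick's theorem: move the variables to the other side as derivatives, one at a time. The first
  derivative hits one of the factors \<open>L b\<close>, and the induction hypothesis treats the rest. The
  factor \<open>q\<close> is invisible to these derivatives, so that the three edges can be treated in turn.
\<close>

lemma apolar_prod_vars:
  assumes "finite S"
    and "\<And>k l. k \<in> S \<Longrightarrow> l \<in> S \<Longrightarrow> pdiff (v k) (L l) = cst (c l k)"
    and "\<And>k. k \<in> S \<Longrightarrow> pdiff (v k) q = 0"
  shows "apolar ((\<Prod>k\<in>S. var (v k)) * p) ((\<Prod>k\<in>S. L k) * q)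
    = (\<Sum>\<sigma> | \<sigma> permutes S. \<Prod>k\<in>S. c (\<sigma> k) k) * apolar p q"
  using assms
proof (induction S arbitrary: L c rule: finite_induct)
  case empty
  then show ?case by simp
next
  case (insert a S)
  let ?I = "insert a S" and ?V = "(\<Prod>k\<in>S. var (v k)) * p"
  have step: "apolar ?V ((\<Prod>k\<in>?I - {b}. L k) * q)
      = (\<Sum>\<sigma> | \<sigma> permutes S. \<Prod>k\<in>S. c (Transposition.transpose a b (\<sigma> k)) k) * apolar p q" if b:
          "b \<in> ?I" for b
  proof -
    have mem: "Transposition.transpose a b l \<in> ?I" if "l \<in> S" for l
      using that b by (auto simp: Transposition.transpose_def)
    have "(\<Prod>k\<in>?I - {b}. L k) = (\<Prod>k\<in>S. L (Transposition.transpose a b k))"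
      using b insert.hyps
      by (intro prod.reindex_bij_witness[where i = "Transposition.transpose a b" and j
          = "Transposition.transpose a b"])
         (auto simp: Transposition.transpose_def)
    then show ?thesis
      using insert.IH[of "\<lambda>l. L (Transposition.transpose a b l)" "\<lambda>l. c
          (Transposition.transpose a b l)"] insert.prems mem by simp
  qed
  have "apolar ((\<Prod>k\<in>?I. var (v k)) * p) ((\<Prod>k\<in>?I. L k) * q)
      = apolar ?V (pdiff (v a) ((\<Prod>k\<in>?I. L k) * q))"
    using insert.hyps by (simp add: mult.assoc apolar_var_mult)
  also have "pdiff (v a) ((\<Prod>k\<in>?I. L k) * q)
      = (\<Sum>b\<in>?I. cst (c b a) * ((\<Prod>k\<in>?I - {b}. L k) * q))"
    using insert.hyps insert.prems
    by (simp only: pdiff_mult pdiff_prod finite_insert)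
        (simp add: sum_distrib_right distrib_right mult.assoc)
  also have "apolar ?V \<dots> = (\<Sum>b\<in>?I. c b a * (\<Sum>\<sigma> | \<sigma> permutes S. \<Prod>k\<in>S. c
      (Transposition.transpose a b (\<sigma> k)) k)) * apolar p q"
    unfolding apolar_sum_right apolar_cst_right sum_distrib_right
    by (rule sum.cong) (simp_all only: step mult.assoc)
  also have "(\<Sum>b\<in>?I. c b a * (\<Sum>\<sigma> | \<sigma> permutes S. \<Prod>k\<in>S. c (Transposition.transpose a b (\<sigma> k)) k))
     = (\<Sum>\<sigma> | \<sigma> permutes ?I. \<Prod>k\<in>?I. c (\<sigma> k) k)"
    unfolding sum_over_permutations_insert[OF insert.hyps] sum_distrib_left
  proof (intro sum.cong refl)
    fix b \<sigma> assume "\<sigma> \<in> {\<sigma>. \<sigma> permutes S}"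
    then have "\<sigma> a = a" using insert.hyps by (simp add: permutes_not_in)
    then show "c b a * (\<Prod>k\<in>S. c (Transposition.transpose a b (\<sigma> k)) k)
        = (\<Prod>k\<in>?I. c ((Transposition.transpose a b \<circ> \<sigma>) k) k)"
      using insert.hyps by simp
  qed
  finally show ?case .
qed

definition gen_word :: "complex^2^2 \<Rightarrow> edge \<Rightarrow> 2 list \<Rightarrow> (edge \<times> 2) cpoly" where
  "gen_word x e w = prod_list (map (gen x e) w)"

lemma gen_word_append: "gen_word x e (u @ w) = gen_word x e u * gen_word x e w"
  by (simp add: gen_word_def)

lemma gen_word_rev: "gen_word x e (rev w) = gen_word x e w"
  by (simp add: gen_word_def rev_map[symmetric] prod_list.rev)

lemma gen_word_eq_prod: "gen_word x e w = (\<Prod>k<length w. gen x e (w ! k))"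
  unfolding gen_word_def prod.list_conv_set_nth by (auto simp: atLeast0LessThan)

lemma pdiff_gen_word_other: "e \<noteq> f \<Longrightarrow> pdiff (e, i) (gen_word x f w) = 0"
  by (induction w) (auto simp: gen_word_def pdiff_mult pdiff_gen)

lemma apolar_gen_wordo:
  assumes "u \<in> words n" "w \<in> words n" and "\<And>i. pdiff (e, i) q = 0"
  shows "apolar (gen_word (mat 1) e u * p) (gen_word x e w * q) = permanent x w u * apolar p q"
  using apolar_prod_vars[of "{..<n}" "\<lambda>k. (e, u ! k)" "\<lambda>k. gen x e (w ! k)"
      "\<lambda>l k. x $ (w ! l) $ (u ! k)" q p] assms
  by (simp add: gen_word_eq_prod gen_one permanent_def pdiff_gen)

text \<open>
  The coordinates of the determinant, hence of a single cup or cap.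
\<close>

definition eps :: "2 \<Rightarrow> 2 \<Rightarrow> complex" where
  "eps i j = (if i = 1 \<and> j = 2 then 1 else if i = 2 \<and> j = 1 then -1 else 0)"

text \<open>
  The coordinates of a nested cup or cap; nesting pairs the letters from the middle outwards.
\<close>

definition nested_eps :: "2 list \<Rightarrow> 2 list \<Rightarrow> complex" where
  "nested_eps g h = prod_list (map2 eps g (rev h))"

lemma strand_ab_eps: "strand_ab x y = (\<Sum>i\<in>UNIV. \<Sum>j\<in>UNIV. cst (eps i j)
    * (gen x EdgeA i * gen y EdgeB j))"
  by (simp add: strand_ab_def sum_2 eps_def cst_minus)

lemma prod_list_map2_strand:
  "length g = length h \<Longrightarrow> prod_list (map2 (\<lambda>i j. cst (f i j) * (gen x e i * gen y e' j)) g h)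
    = cst (prod_list (map2 f g h)) * (gen_word x e g * gen_word y e' h)"
  by (induction g h rule: list_induct2) (simp_all add: gen_word_def cst_mult mult_ac)

text \<open>
  The reversal in \<open>nested_eps\<close> only permutes the words \<open>h\<close>, and the commuting product of
  generators does not see it.
\<close>

lemma strand_ab_power:
  "strand_ab x y ^ n = (\<Sum>g\<in>words n. \<Sum>h\<in>words n. cst (nested_eps g h)
      * (gen_word x EdgeA g * gen_word y EdgeB h))"
proof -
  have "strand_ab x y ^ n
    = (\<Sum>g\<in>words n. \<Sum>h\<in>words n. cst (prod_list (map2 eps g h))
        * (gen_word x EdgeA g * gen_word y EdgeB h))"
    unfolding strand_ab_eps power_sum_words2 by (intro sum.cong refl prod_list_map2_strand) simp
  also have "\<dots> = (\<Sum>g\<in>words n. \<Sum>h\<in>words n. cst (nested_eps g h)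
      * (gen_word x EdgeA g * gen_word y EdgeB h))"
    by (subst sum_words_rev[symmetric]) (simp add: nested_eps_def gen_word_rev)
  finally show ?thesis .
qed

lemma gen_word_mult_list:
  "prod_list (map (\<lambda>i. gen x e i * gen y e' i) w) = gen_word x e w * gen_word y e' w"
  by (induction w) (simp_all add: gen_word_def mult_ac)

lemma strand_ac_power: "strand_ac x ^ n = (\<Sum>w\<in>words n. gen_word x EdgeA w * gen_word
    (mat 1) EdgeC w)"
  unfolding strand_ac_def power_sum_words gen_word_mult_list ..

lemma strand_bc_power: "strand_bc y ^ n = (\<Sum>w\<in>words n. gen_word y EdgeB w * gen_word
    (mat 1) EdgeC w)"
  unfolding strand_bc_def power_sum_words gen_word_mult_list ..

text \<open>
  The words are concatenated in the order of the tensor factors of the edges a, b and c. The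
  trailing 1 is the remaining factor in the last application of \<open>apolar_gen_word\<close>.
\<close>

lemma vertex_expand:
  "vertex x y \<alpha> \<beta> \<gamma> = (\<Sum>p\<in>words \<beta>. \<Sum>q\<in>words \<alpha>. \<Sum>g\<in>words \<gamma>. \<Sum>h\<in>words \<gamma>.
     cst (nested_eps g h) *
       (gen_word x EdgeA (p @ g) * (gen_word y EdgeB (h @ q)
           * (gen_word (mat 1) EdgeC (p @ q) * 1))))"
  unfolding vertex_def strand_ac_power strand_bc_power strand_ab_power
  unfolding mult.assoc sum_distrib_right unfolding sum_distrib_left
  by (intro sum.cong refl) (simp add: gen_word_append mult_ac)

lemma theta_expand:
  "theta x y \<alpha> \<beta> \<gamma> = (\<Sum>p\<in>words \<beta>. \<Sum>q\<in>words \<alpha>. \<Sum>g\<in>words \<gamma>. \<Sum>h\<in>words \<gamma>.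
     \<Sum>p'\<in>words \<beta>. \<Sum>q'\<in>words \<alpha>. \<Sum>g'\<in>words \<gamma>. \<Sum>h'\<in>words \<gamma>.
       nested_eps g' h' * nested_eps g h * permanent x (p @ g) (p' @ g')
         * permanent y (h @ q) (h' @ q') * permanent (mat 1) (p @ q) (p' @ q'))"
proof -
  have pair: "apolar (gen_word (mat 1) EdgeA (p' @ g') * (gen_word (mat 1) EdgeB (h' @ q')
      * (gen_word (mat 1) EdgeC (p' @ q') * 1)))
       (gen_word x EdgeA (p @ g) * (gen_word y EdgeB (h @ q)
           * (gen_word (mat 1) EdgeC (p @ q) * 1)))
     = permanent x (p @ g) (p' @ g') * (permanent y (h @ q) (h' @ q') * permanent (mat 1) (p @ q)
         (p' @ q'))"
    if "p \<in> words \<beta>" "p' \<in> words \<beta>" "q \<in> words \<alpha>" "q' \<in> words \<alpha>"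
      "g \<in> words \<gamma>" "g' \<in> words \<gamma>" "h \<in> words \<gamma>" "h' \<in> words \<gamma>" for p p' q q' g g' h h'
  proof -
    have w: "p' @ g' \<in> words (\<beta> + \<gamma>)" "p @ g \<in> words (\<beta> + \<gamma>)" "h' @ q' \<in> words (\<gamma> + \<alpha>)"
      "h @ q \<in> words (\<gamma> + \<alpha>)" "p' @ q' \<in> words (\<beta> + \<alpha>)" "p @ q \<in> words (\<beta> + \<alpha>)"
      using that by simp_all
    show ?thesis
      by (subst apolar_gen_wordo[OF w(1,2)], simp add: pdiff_mult pdiff_gen_word_other,
          subst apolar_gen_wordo[OF w(3,4)], simp add: pdiff_mult pdiff_gen_word_other,
          subst apolar_gen_wordo[OF w(5,6)]) (simp_all add: apolar_1)
  qed
  show ?thesis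
    unfolding theta_def vertex_expand
    unfolding apolar_sum_right unfolding apolar_sum_left apolar_cst_left apolar_cst_right
    unfolding sum_distrib_left
    by (intro sum.cong refl) (simp only: pair, simp)
qed

section \<open>Coordinates of the tensor maps\<close>

lemma scaleT_apply [simp]: "scaleT z T w = z * T w"
  by (simp add: scaleT_def)

lemma sum_tensor_apply: "(\<Sum>i\<in>A. f i :: tensor) w = (\<Sum>i\<in>A. f i w)"
  by (induction A rule: infinite_finite_induct) simp_all

lemma basis_tensor_apply: "basis_tensor u w = (if w = u then 1 else 0)"
  by (auto simp: basis_tensor_def pure_def std_vec_def axis_def list_eq_iff_nth_eq prod_zero_iff)

lemma basis_tensor_tpow: "u \<in> words n \<Longrightarrow> basis_tensor u \<in> tpow n"
  by (auto simp: tpow_def basis_tensor_apply)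

lemma tpowD: "T \<in> tpow n \<Longrightarrow> length w \<noteq> n \<Longrightarrow> T w = 0"
  by (simp add: tpow_def)

lemma lin_ext_apply: "lin_ext n \<phi> T w = (\<Sum>u\<in>words n. T u * \<phi> (map std_vec u) w)"
  by (simp add: lin_ext_def sum_tensor_apply)

lemma lin_ext_basis: "u \<in> words n \<Longrightarrow> lin_ext n \<phi> (basis_tensor u) = \<phi> (map std_vec u)"
  by (rule ext) (simp add: lin_ext_apply basis_tensor_apply if_distrib[of "\<lambda>z. z
      * _"] cong: if_cong)

lemma tensor_prod_apply:
  assumes "S \<in> tpow m" "T \<in> tpow n"
  shows "tensor_prod S T w = (if length w = m + n then S (take m w) * T (drop m w) else 0)"
proof -
  have "tensor_prod S T w
    = (\<Sum>k\<le>length w. if k = m then (if length w = m + n then S (take m w) * T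
        (drop m w) else 0) else 0)"
    unfolding tensor_prod_def
  proof (intro sum.cong refl)
    fix k assume "k \<in> {..length w}"
    then show "S (take k w) * T (drop k w)
      = (if k = m then (if length w = m + n then S (take m w) * T (drop m w) else 0) else 0)"
    proof (cases "k = m \<and> length w = m + n")
      case False
      with \<open>k \<in> _\<close> have "length (take k w) \<noteq> m \<or> length (drop k w) \<noteq> n" by auto
      with False show ?thesis using tpowD[OF assms(1)] tpowD[OF assms(2)] by auto
    qed simp
  qed
  then show ?thesis by simp
qed

lemma tensor_map_sum_apply: "tensor_map m n f g T w = (\<Sum>u\<in>words m. \<Sum>v\<in>words n.
    T (u @ v) * tensor_prod (f (basis_tensor u)) (g (basis_tensor v)) w)"
  by (simp add: tensor_map_def sum_tensor_apply)

lemma tensor_map_tpow: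
  assumes "\<And>u. u \<in> words m \<Longrightarrow> f (basis_tensor u) \<in> tpow m'"
    and "\<And>v. v \<in> words n \<Longrightarrow> g (basis_tensor v) \<in> tpow n'"
  shows "tensor_map m n f g T \<in> tpow (m' + n')"
  using tensor_prod_apply[OF assms] by (simp add: tpow_def tensor_map_sum_apply)

lemma tensor_map_apply:
  assumes "\<And>u. u \<in> words m \<Longrightarrow> f (basis_tensor u) \<in> tpow m'"
    and "\<And>v. v \<in> words n \<Longrightarrow> g (basis_tensor v) \<in> tpow n'"
    and "length w1 = m'" "length w2 = n'"
  shows "tensor_map m n f g T (w1 @ w2) = (\<Sum>u\<in>words m. \<Sum>v\<in>words n.
    T (u @ v) * (f (basis_tensor u) w1 * g (basis_tensor v) w2))"
  unfolding tensor_map_sum_apply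
  by (intro sum.cong refl) (simp only: tensor_prod_apply[OF assms(1,2)], simp add: assms)

lemma tensor_map_basis_apply:
  assumes "\<And>u. u \<in> words m \<Longrightarrow> f (basis_tensor u) \<in> tpow m'"
    and "\<And>v. v \<in> words n \<Longrightarrow> g (basis_tensor v) \<in> tpow n'"
    and "length w1 = m'" "length w2 = n'" and uv: "u \<in> words m" "v \<in> words n"
  shows "tensor_map m n f g (basis_tensor (u @ v)) (w1 @ w2)
    = f (basis_tensor u) w1 * g (basis_tensor v) w2"
proof -
  have "tensor_map m n f g (basis_tensor (u @ v)) (w1 @ w2) = (\<Sum>u'\<in>words m. \<Sum>v'\<in>words n.
     basis_tensor (u @ v) (u' @ v') * (f (basis_tensor u') w1 * g (basis_tensor v') w2))"
    by (rule tensor_map_apply[where m' = m' and n' = n']) (fact assms)+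
  also have "\<dots> = (\<Sum>u'\<in>words m. \<Sum>v'\<in>words n.
     if v' = v then (if u' = u then f (basis_tensor u) w1 * g (basis_tensor v) w2 else 0) else 0)"
    using uv by (intro sum.cong refl) (auto simp: basis_tensor_apply)
  also have "\<dots> = f (basis_tensor u) w1 * g (basis_tensor v) w2"
    using uv by simp
  finally show ?thesis .
qed

lemma whisker_tpow:
  assumes "\<And>u. u \<in> words m \<Longrightarrow> f (basis_tensor u) \<in> tpow m'"
  shows "whisker p q m f T \<in> tpow (p + (m' + q))"
  unfolding whisker_def
  by (intro tensor_map_tpow) (auto intro!: tensor_map_tpow assms basis_tensor_tpow)

lemma whisker_apply:
  assumes f: "\<And>u. u \<in> words m \<Longrightarrow> f (basis_tensor u) \<in> tpow m'"
    and w: "length w0 = p" "length w1 = m'" "length w2 = q"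
  shows "whisker p q m f T (w0 @ w1 @ w2) = (\<Sum>u\<in>words m. T (w0 @ u @ w2) * f (basis_tensor u) w1)"
proof -
  have id: "id (basis_tensor u) \<in> tpow n" if "u \<in> words n" for u n
    using basis_tensor_tpow[OF that] by simp
  have G: "tensor_map m q f id T' \<in> tpow (m' + q)" for T'
    by (intro tensor_map_tpow f id)
  have "whisker p q m f T (w0 @ w1 @ w2) = (\<Sum>u0\<in>words p. \<Sum>v\<in>words (m + q).
     T (u0 @ v) * (basis_tensor u0 w0 * tensor_map m q f id (basis_tensor v) (w1 @ w2)))"
    unfolding whisker_def using w by (subst tensor_map_apply[where f = id, OF id G]) simp_all
  also have "\<dots> = (\<Sum>u0\<in>words p. if u0 = w0 then \<Sum>v\<in>words (m + q).
     T (w0 @ v) * tensor_map m q f id (basis_tensor v) (w1 @ w2) else 0)"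
    by (intro sum.cong refl) (simp add: basis_tensor_apply)
  also have "\<dots> = (\<Sum>v\<in>words (m + q). T (w0 @ v) * tensor_map m q f id (basis_tensor v) (w1 @ w2))"
    using w by simp
  also have "\<dots> = (\<Sum>u\<in>words m. \<Sum>v\<in>words q. T (w0 @ u @ v)
      * (f (basis_tensor u) w1 * basis_tensor v w2))"
    unfolding sum_words_append
    using w by (intro sum.cong refl) (subst tensor_map_basis_apply[where f = f and g
        = id, OF f id]; simp)
  also have "\<dots> = (\<Sum>u\<in>words m. T (w0 @ u @ w2) * f (basis_tensor u) w1)"
    using w by (intro sum.cong refl)
      (simp add: basis_tensor_apply if_distrib[of "\<lambda>z. _ * z"] cong: if_cong)
  finally show ?thesis .
qed

lemma tpow_map_basis:
  assumes "u \<in> words n"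
  shows "tpow_map n x (basis_tensor u) \<in> tpow n"
    and "w \<in> words n \<Longrightarrow> tpow_map n x (basis_tensor u) w = (\<Prod>k<n. x $ (w ! k) $ (u ! k))"
proof -
  have "(x *v std_vec j) $ i = x $ i $ j" for i j
    by (simp add: std_vec_def matrix_vector_mult_def axis_def if_distrib[of "\<lambda>z. _
        * z"] cong: if_cong)
  then have "tpow_map n x (basis_tensor u) = (\<lambda>w. if length w
      = n then \<Prod>k<n. x $ (w ! k) $ (u ! k) else 0)"
    using assms by (auto simp: tpow_map_def lin_ext_basis pure_def fun_eq_iff)
  then show "tpow_map n x (basis_tensor u) \<in> tpow n"
    "w \<in> words n \<Longrightarrow> tpow_map n x (basis_tensor u) w = (\<Prod>k<n. x $ (w ! k) $ (u ! k))"
    by (simp_all add: tpow_def)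
qed

lemma symmetrizer_basis:
  assumes u: "u \<in> words n"
  shows "symmetrizer n (basis_tensor u) \<in> tpow n"
    and "w \<in> words n \<Longrightarrow> symmetrizer n (basis_tensor u) w = permanent (mat 1) w u / fact n"
proof -
  have "pure (permute_list \<sigma> (map std_vec u)) w = (if w = permute_list \<sigma> u then 1 else 0)"
    if "\<sigma> permutes {..<n}" for \<sigma> w
    using that u by (simp add: permute_list_map basis_tensor_apply[unfolded basis_tensor_def])
  then have *: "symmetrizer n (basis_tensor u) w
      = 1 / fact n * (\<Sum>\<sigma> | \<sigma> permutes {..<n}. if w = permute_list \<sigma> u then 1 else 0)" for w
    unfolding symmetrizer_def lin_ext_basis[OF u] scaleT_apply sum_tensor_apply
    by (intro arg_cong2[where f = "(*)"] sum.cong) auto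
  show "symmetrizer n (basis_tensor u) \<in> tpow n"
    using u by (auto simp: tpow_def * intro!: sum.neutral)
  show "symmetrizer n (basis_tensor u) w = permanent (mat 1) w u / fact n" if "w \<in> words n"
    unfolding * permanent_eq_sum_permute_list[OF that u] by simp
qed

lemma symmetrizer_expand:
  "symmetrizer n T = (\<Sum>w\<in>words n. scaleT (T w) (symmetrizer n (basis_tensor w)))"
  unfolding symmetrizer_def by (subst lin_ext_def, intro sum.cong refl) (simp only: lin_ext_basis)

subsection \<open>Cups and caps\<close>

lemma cup1_basis: "cup1 (basis_tensor []) \<in> tpow 2" "cup1 (basis_tensor []) [i, j] = eps i j"
proof -
  have eq: "cup1 (basis_tensor []) = basis_tensor [1, 2] - basis_tensor [2, 1]"
    unfolding cup1_def by (subst lin_ext_basis) (simp_all add: basis_tensor_def)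
  show "cup1 (basis_tensor []) \<in> tpow 2"
    unfolding eq by (auto simp: tpow_def basis_tensor_apply)
  show "cup1 (basis_tensor []) [i, j] = eps i j"
    unfolding eq by (auto simp: basis_tensor_apply eps_def)
qed

lemma cap1_basis:
  "cap1 (basis_tensor [i, j]) \<in> tpow 0" "cap1 (basis_tensor [i, j]) [] = eps i j"
proof -
  have "cap1 (basis_tensor [i, j]) = scaleT (det (\<chi> k l. if l
      = 1 then (map std_vec [i, j] ! 0) $ k else (map std_vec [i, j] ! 1) $ k)) (pure [])"
    unfolding cap1_def by (subst lin_ext_basis) simp_all
  also have "det (\<chi> k l. if l = 1 then (map std_vec [i, j] ! 0) $ k else
      (map std_vec [i, j] ! 1) $ k :: complex^2^2) = eps i j"
    using exhaust_2[of i] exhaust_2[of j] by (auto simp: det_2 std_vec_def axis_def eps_def)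
  finally have eq: "cap1 (basis_tensor [i, j]) = scaleT (eps i j) (pure [])" .
  show "cap1 (basis_tensor [i, j]) \<in> tpow 0" "cap1 (basis_tensor [i, j]) [] = eps i j"
    unfolding eq by (simp_all add: tpow_def pure_def)
qed

lemma nested_eps_snoc_Cons:
  "length g = length h \<Longrightarrow> nested_eps (g @ [i]) (j # h) = nested_eps g h * eps i j"
  by (simp add: nested_eps_def)

lemma cup_basis:
  "cup n (basis_tensor []) \<in> tpow (n + n)"
  "length g = n \<Longrightarrow> length h = n \<Longrightarrow> cup n (basis_tensor []) (g @ h) = nested_eps g h"
proof (induction n arbitrary: g h)
  case 0
  {
    case 1
    show ?case by (simp add: basis_tensor_tpow)
  next
    case 2
    then show ?case by (simp add: basis_tensor_apply nested_eps_def)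
  }
next
  case (Suc n)
  {
    case 1
    have "whisker n n 0 cup1 T \<in> tpow (n + (2 + n))" for T
      by (rule whisker_tpow) (simp add: cup1_basis)
    then show ?case by (simp add: add.commute)
  next
    case 2
    obtain g' i where g: "g = g' @ [i]" "length g' = n" using 2(1) by (cases g rule: rev_cases) auto
    obtain j h' where h: "h = j # h'" "length h' = n" using 2(2) by (metis length_Suc_conv)
    have "cup (Suc n) (basis_tensor []) (g @ h) = whisker n n 0 cup1 (cup n (basis_tensor []))
        (g' @ [i, j] @ h')"
      by (simp add: g h)
    also have "\<dots> = nested_eps g' h' * eps i j"
      using g h Suc.IH(2)[of g' h'] by (subst whisker_apply[where m'
          = 2]) (simp_all add: cup1_basis)
    finally show ?case using g h by (simp add: nested_eps_snoc_Cons)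
  }
qed

lemma cap1_words: "u \<in> words 2 \<Longrightarrow> cap1 (basis_tensor u) \<in> tpow 0"
  by (auto simp: numeral_2_eq_2 length_Suc_conv cap1_basis(1)[unfolded numeral_2_eq_2])

lemma cap_tpow: "T \<in> tpow (n + n) \<Longrightarrow> cap n T \<in> tpow 0"
proof (induction n arbitrary: T)
  case (Suc n)
  have "whisker n n 2 cap1 T \<in> tpow (n + (0 + n))"
    by (rule whisker_tpow) (rule cap1_words)
  then show ?case using Suc.IH by simp
qed simp

lemma cap_apply: "cap n T [] = (\<Sum>g\<in>words n. \<Sum>h\<in>words n. T (g @ h) * nested_eps g h)"
proof (induction n arbitrary: T)
  case 0
  show ?case by (simp add: nested_eps_def)
next
  case (Suc n)
  have "cap (Suc n) T [] = (\<Sum>g\<in>words n. \<Sum>h\<in>words n. whisker n n 2 cap1 T (g @ [] @ h)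
      * nested_eps g h)"
    by (simp add: Suc.IH)
  also have "\<dots> = (\<Sum>g\<in>words n. \<Sum>h\<in>words n. (\<Sum>i\<in>UNIV. \<Sum>j\<in>UNIV. T (g @ [i, j] @ h) * eps i j)
      * nested_eps g h)"
  proof (intro sum.cong refl)
    fix g h assume "g \<in> words n" "h \<in> words n"
    then have "whisker n n 2 cap1 T (g @ [] @ h) = (\<Sum>u\<in>words 2. T (g @ u @ h) * cap1
        (basis_tensor u) [])"
      by (intro whisker_apply) (simp_all add: cap1_words)
    also have "\<dots> = (\<Sum>i\<in>UNIV. \<Sum>j\<in>UNIV. T (g @ [i, j] @ h) * eps i j)"
      unfolding numeral_2_eq_2 by (simp add: sum_words_Suc cap1_basis)
    finally show "whisker n n 2 cap1 T (g @ [] @ h) * nested_eps g h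
      = (\<Sum>i\<in>UNIV. \<Sum>j\<in>UNIV. T (g @ [i, j] @ h) * eps i j) * nested_eps g h" by simp
  qed
  also have "\<dots> = (\<Sum>g\<in>words n. \<Sum>h\<in>words n. \<Sum>i\<in>UNIV. \<Sum>j\<in>UNIV.
      T ((g @ [i]) @ (j # h)) * nested_eps (g @ [i]) (j # h))"
    unfolding sum_distrib_right
    by (intro sum.cong refl) (subst nested_eps_snoc_Cons, auto)
  also have "\<dots> = (\<Sum>g\<in>words n. \<Sum>i\<in>UNIV. \<Sum>h\<in>words n. \<Sum>j\<in>UNIV.
      T ((g @ [i]) @ (j # h)) * nested_eps (g @ [i]) (j # h))"
    by (intro sum.cong refl sum.swap)
  also have "\<dots> = (\<Sum>g\<in>words n. \<Sum>i\<in>UNIV. \<Sum>j\<in>UNIV. \<Sum>h\<in>words n.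
      T ((g @ [i]) @ (j # h)) * nested_eps (g @ [i]) (j # h))"
    by (intro sum.cong refl sum.swap)
  finally show ?case by (simp only: sum_words_snoc[of _ n] sum_words_Suc[of "\<lambda>h. _ (_ @ h)
      * _ _ h"])
qed

section \<open>The trace over the symmetric power\<close>

definition tensor_linear :: "(tensor \<Rightarrow> tensor) \<Rightarrow> bool" where
  "tensor_linear f \<longleftrightarrow>
     (\<forall>S T. f (S + T) = f S + f T) \<and> (\<forall>z T. f (scaleT z T) = scaleT z (f T))"

lemma tensor_linear_sum:
  assumes "tensor_linear f"
  shows "f (\<Sum>i\<in>A. scaleT (c i) (g i)) = (\<Sum>i\<in>A. scaleT (c i) (f (g i)))"
proof -
  have "scaleT 0 T = 0" for T by (simp add: fun_eq_iff)
  then have "f 0 = 0" using assms unfolding tensor_linear_def by metis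
  then show ?thesis
    using assms by (induction A rule: infinite_finite_induct) (simp_all add: tensor_linear_def)
qed

lemma tensor_linear_comp: "tensor_linear f \<Longrightarrow> tensor_linear g \<Longrightarrow> tensor_linear (f \<circ> g)"
  by (simp add: tensor_linear_def)

lemma tensor_linear_tensor_map: "tensor_linear (tensor_map m n f g)"
  by (simp add: tensor_linear_def fun_eq_iff tensor_map_sum_apply distrib_right sum.distrib
      sum_distrib_left mult.assoc)

lemma tensor_linear_whisker: "tensor_linear (whisker p q m f)"
  unfolding whisker_def by (rule tensor_linear_tensor_map)

lemma tensor_linear_lin_ext: "tensor_linear (lin_ext n \<phi>)"
  by (simp add: tensor_linear_def fun_eq_iff lin_ext_apply distrib_right sum.distrib
      sum_distrib_left mult.assoc)

lemma tensor_linear_symmetrizer: "tensor_linear (symmetrizer n)"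
  unfolding symmetrizer_def by (rule tensor_linear_lin_ext)

lemma subspace_sympow: "tensor.subspace (sympow n)"
proof (rule tensor.subspaceI)
  have "symmetrizer n 0 = 0"
    using tensor_linear_sum[OF tensor_linear_symmetrizer, of n _ _ "{}"] by simp
  moreover have "0 \<in> tpow n" by (simp add: tpow_def)
  ultimately show "0 \<in> sympow n" unfolding sympow_def by force
next
  fix S T assume "S \<in> sympow n" "T \<in> sympow n"
  then obtain S' T' where "S' \<in> tpow n" "S = symmetrizer n S'" "T' \<in> tpow n" "T = symmetrizer n T'"
    by (auto simp: sympow_def)
  then have "S + T = symmetrizer n (S' + T')" "S' + T' \<in> tpow n"
    using tensor_linear_symmetrizer by (simp_all add: tensor_linear_def tpow_def)
  then show "S + T \<in> sympow n" unfolding sympow_def by blast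
next
  fix z T assume "T \<in> sympow n"
  then obtain T' where "T' \<in> tpow n" "T = symmetrizer n T'"
    by (auto simp: sympow_def)
  then have "scaleT z T = symmetrizer n (scaleT z T')" "scaleT z T' \<in> tpow n"
    using tensor_linear_symmetrizer by (simp_all add: tensor_linear_def tpow_def)
  then show "scaleT z T \<in> sympow n" unfolding sympow_def by blast
qed

text \<open>
  Expand the symmetrized basis tensor \<open>e w\<close> in a basis of the symmetric power. For b in that
  basis, applying the symmetrizer to \<open>M b\<close> amounts to replacing each word w in it by \<open>e w\<close>, so
  both sides are the sum over b and w of the b-coordinate of \<open>e w\<close> times the w-coordinate of \<open>M
  b\<close>.
\<close>

lemma trace_on_sympow:
  assumes "tensor_linear M"
  shows "trace_on (sympow c) (symmetrizer c \<circ> M)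
    = (\<Sum>w\<in>words c. M (symmetrizer c (basis_tensor w)) w)"
proof -
  define B where "B = (SOME B. tensor.independent B \<and> tensor.span B = sympow c)"
  define e where "e w = symmetrizer c (basis_tensor w)" for w
  define R where "R = tensor.representation B"
  obtain B' where "B' \<subseteq> sympow c" "tensor.independent B'" "sympow c \<subseteq> tensor.span B'"
    using tensor.basis_exists[of "sympow c"] by metis
  then have "tensor.independent B' \<and> tensor.span B' = sympow c"
    using tensor.span_subspace[OF _ _ subspace_sympow] by blast
  then have B: "tensor.independent B" "tensor.span B = sympow c"
    unfolding B_def by (metis (mono_tags, lifting) someI_ex)+
  have "sympow c \<subseteq> tensor.span (e ` words c)"
  proof
    fix S assume "S \<in> sympow c"
    then obtain T where "S = (\<Sum>w\<in>words c. scaleT (T w) (e w))"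
      unfolding sympow_def e_def using symmetrizer_expand by blast
    then show "S \<in> tensor.span (e ` words c)"
      by (simp only:) (rule tensor.span_sum, rule tensor.span_scale, rule tensor.span_base, rule
          imageI)
  qed
  then have "B \<subseteq> tensor.span (e ` words c)"
    using B(2) tensor.span_superset by blast
  then have fin: "finite B"
    using tensor.independent_span_bound[of "e ` words c" B] B(1) by simp
  have e: "e w \<in> tensor.span B" if "w \<in> words c" for w
    unfolding B(2) sympow_def e_def using basis_tensor_tpow[OF that] by (rule imageI)
  have "R (symmetrizer c (M b)) b = (\<Sum>w\<in>words c. M b w * R (e w) b)" for b
  proof -
    have "R (symmetrizer c (M b)) = (\<lambda>b'. \<Sum>w\<in>words c. R (scaleT (M b w) (e w)) b')"
      unfolding R_def symmetrizer_expand[of c "M b"] e_def[symmetric]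
      using e by (intro tensor.representation_sum B tensor.span_scale) auto
    then have "R (symmetrizer c (M b)) b = (\<Sum>w\<in>words c. R (scaleT (M b w) (e w)) b)"
      by simp
    also have "\<dots> = (\<Sum>w\<in>words c. M b w * R (e w) b)"
      unfolding R_def by (intro sum.cong refl) (simp only: tensor.representation_scale[OF B(1) e])
    finally show ?thesis .
  qed
  then have "trace_on (sympow c) (symmetrizer c \<circ> M) = (\<Sum>b\<in>B. \<Sum>w\<in>words c. R (e w) b * M b w)"
    unfolding trace_on_def Let_def B_def[symmetric] R_def[symmetric] by (simp add: mult.commute)
  also have "\<dots> = (\<Sum>w\<in>words c. \<Sum>b\<in>B. R (e w) b * M b w)"
    by (rule sum.swap)
  also have "\<dots> = (\<Sum>w\<in>words c. M (e w) w)"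
  proof (intro sum.cong refl)
    fix w assume "w \<in> words c"
    then have "e w = (\<Sum>b\<in>B. scaleT (R (e w) b) b)"
      unfolding R_def using tensor.sum_representation_eq[OF B(1) e fin subset_refl] by simp
    then have "M (e w) = (\<Sum>b\<in>B. scaleT (R (e w) b) (M b))"
      using tensor_linear_sum[OF assms, of "R (e w)" "\<lambda>b. b" B] by simp
    then show "(\<Sum>b\<in>B. R (e w) b * M b w) = M (e w) w"
      by (simp add: sum_tensor_apply)
  qed
  finally show ?thesis unfolding e_def .
qed

section \<open>Central functions as theta networks\<close>

lemma admissible_sum: "admissible (\<beta> + \<gamma>) (\<gamma> + \<alpha>) (\<beta> + \<alpha>)"
proof -
  have "(- real (\<beta> + \<gamma>) + real (\<gamma> + \<alpha>) + real (\<beta> + \<alpha>)) / 2 = real \<alpha>"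
    "(real (\<beta> + \<gamma>) - real (\<gamma> + \<alpha>) + real (\<beta> + \<alpha>)) / 2 = real \<beta>"
    "(real (\<beta> + \<gamma>) + real (\<gamma> + \<alpha>) - real (\<beta> + \<alpha>)) / 2 = real \<gamma>"
    by simp_all
  then show ?thesis unfolding admissible_def by simp
qed

lemma admissibleE:
  assumes "admissible a b c"
  obtains \<alpha> \<beta> \<gamma> where "a = \<beta> + \<gamma>" "b = \<gamma> + \<alpha>" "c = \<beta> + \<alpha>"
proof -
  obtain \<alpha> \<beta> \<gamma> where "(- real a + real b + real c) / 2 = real \<alpha>"
    "(real a - real b + real c) / 2 = real \<beta>" "(real a + real b - real c) / 2 = real \<gamma>"
    using assms unfolding admissible_def by (auto elim!: Nats_cases)
  then have "real a = real (\<beta> + \<gamma>)" "real b = real (\<gamma> + \<alpha>)" "real c = real (\<beta> + \<alpha>)"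
    by (simp_all add: field_simps)
  then show thesis using that by (simp only: of_nat_eq_iff)
qed

lemma sum_rotate: "(\<Sum>g\<in>B. \<Sum>h\<in>C. \<Sum>q\<in>A. F g h q) = (\<Sum>q\<in>A. \<Sum>g\<in>B. \<Sum>h\<in>C. F g h q)"
  (is "?l = ?r")
proof -
  have "?l = (\<Sum>g\<in>B. \<Sum>q\<in>A. \<Sum>h\<in>C. F g h q)"
    by (intro sum.cong refl sum.swap)
  also have "\<dots> = ?r"
    by (rule sum.swap)
  finally show ?thesis .
qed

lemma iota_apply:
  assumes "length w1 = \<beta> + \<gamma>" "length w2 = \<gamma> + \<alpha>"
  shows "iota (\<beta> + \<gamma>) (\<gamma> + \<alpha>) (\<beta> + \<alpha>) T (w1 @ w2)
    = (\<Sum>p\<in>words \<beta>. \<Sum>g\<in>words \<gamma>. \<Sum>h\<in>words \<gamma>. \<Sum>q\<in>words \<alpha>. T (p @ q) * nested_eps g h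
        * (permanent (mat 1) w1 (p @ g) * permanent (mat 1) w2 (h @ q)))
      / (fact (\<beta> + \<gamma>) * fact (\<gamma> + \<alpha>))"
proof -
  let ?a = "\<beta> + \<gamma>" and ?b = "\<gamma> + \<alpha>"
  define K where "K = whisker \<beta> \<alpha> 0 (cup \<gamma>) T"
  have K: "K ((p @ g) @ (h @ q)) = T (p @ q) * nested_eps g h"
    if "p \<in> words \<beta>" "g \<in> words \<gamma>" "h \<in> words \<gamma>" "q \<in> words \<alpha>" for p g h q
  proof -
    have "K (p @ (g @ h) @ q) = (\<Sum>u\<in>words 0. T (p @ u @ q) * cup \<gamma> (basis_tensor u) (g @ h))"
      unfolding K_def using that
      by (intro whisker_apply[where m' = "\<gamma> + \<gamma>"]) (simp_all add: cup_basis)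
    then show ?thesis using that by (simp add: cup_basis)
  qed
  have "iota ?a ?b (\<beta> + \<alpha>) T = tensor_map ?a ?b (symmetrizer ?a) (symmetrizer ?b) K"
    by (simp add: iota_def adm_alpha_def adm_beta_def adm_gamma_def K_def)
  then have "iota ?a ?b (\<beta> + \<alpha>) T (w1 @ w2) = (\<Sum>u\<in>words ?a. \<Sum>v\<in>words ?b. K (u @ v) *
      (symmetrizer ?a (basis_tensor u) w1 * symmetrizer ?b (basis_tensor v) w2))"
    by (simp only:, intro tensor_map_apply[where m' = ?a and n' = ?b] symmetrizer_basis(1))
       (use assms in simp_all)
  also have "\<dots> = (\<Sum>u\<in>words ?a. \<Sum>v\<in>words ?b. K (u @ v) *
      (permanent (mat 1) w1 u * permanent (mat 1) w2 v)) / (fact ?a * fact ?b)"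
    unfolding sum_divide_distrib using assms
    by (intro sum.cong refl) (simp add: symmetrizer_basis(2))
  also have "(\<Sum>u\<in>words ?a. \<Sum>v\<in>words ?b. K (u @ v) *
      (permanent (mat 1) w1 u * permanent (mat 1) w2 v))
    = (\<Sum>p\<in>words \<beta>. \<Sum>g\<in>words \<gamma>. \<Sum>h\<in>words \<gamma>. \<Sum>q\<in>words \<alpha>. T (p @ q) * nested_eps g h
        * (permanent (mat 1) w1 (p @ g) * permanent (mat 1) w2 (h @ q)))"
    unfolding sum_words_append by (intro sum.cong refl) (simp only: K)
  finally show ?thesis .
qed

text \<open>
  On the edges a and b, the group element acts on a symmetrizer; by \<open>permanent_collapse\<close> the two
  merge into the permanent for that group element.
\<close>

lemma tensor_map_tpow_map_iota_apply:
  assumes "z1 \<in> words (\<beta> + \<gamma>)" "z2 \<in> words (\<gamma> + \<alpha>)"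
  shows "tensor_map (\<beta> + \<gamma>) (\<gamma> + \<alpha>) (tpow_map (\<beta> + \<gamma>) x) (tpow_map (\<gamma> + \<alpha>) y)
      (iota (\<beta> + \<gamma>) (\<gamma> + \<alpha>) (\<beta> + \<alpha>) T) (z1 @ z2)
    = (\<Sum>p\<in>words \<beta>. \<Sum>q\<in>words \<alpha>. \<Sum>g\<in>words \<gamma>. \<Sum>h\<in>words \<gamma>. T (p @ q) * nested_eps g h
        * (permanent x z1 (p @ g) * permanent y z2 (h @ q)))
      / (fact (\<beta> + \<gamma>) * fact (\<gamma> + \<alpha>))"
proof -
  let ?a = "\<beta> + \<gamma>" and ?b = "\<gamma> + \<alpha>"
  let ?X = "\<lambda>w. \<Prod>k<?a. x $ (z1 ! k) $ (w ! k)" and ?Y = "\<lambda>w. \<Prod>k<?b. y $ (z2 ! k) $ (w ! k)"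
  define I where "I = iota ?a ?b (\<beta> + \<alpha>) T"
  have "tensor_map ?a ?b (tpow_map ?a x) (tpow_map ?b y) I (z1 @ z2)
     = (\<Sum>w1\<in>words ?a. \<Sum>w2\<in>words ?b. I (w1 @ w2) *
         (tpow_map ?a x (basis_tensor w1) z1 * tpow_map ?b y (basis_tensor w2) z2))"
    by (intro tensor_map_apply[where m' = ?a and n' = ?b] tpow_map_basis(1)) (use assms in simp_all)
  also have "\<dots> = (\<Sum>w1\<in>words ?a. \<Sum>w2\<in>words ?b. I (w1 @ w2) * (?X w1 * ?Y w2))"
    using assms by (intro sum.cong refl) (simp only: tpow_map_basis(2))
  also have "\<dots> = (\<Sum>w1\<in>words ?a. \<Sum>w2\<in>words ?b.
      \<Sum>p\<in>words \<beta>. \<Sum>g\<in>words \<gamma>. \<Sum>h\<in>words \<gamma>. \<Sum>q\<in>words \<alpha>. T (p @ q) * nested_eps g h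
        * ((?X w1 * permanent (mat 1) w1 (p @ g)) * (?Y w2 * permanent (mat 1) w2 (h @ q))))
      / (fact ?a * fact ?b)"
    unfolding sum_divide_distrib[of _ "words _" "fact ?a * fact ?b"]
  proof (intro sum.cong refl)
    fix w1 w2 assume "w1 \<in> words ?a" "w2 \<in> words ?b"
    then have "length w1 = ?a" "length w2 = ?b" by simp_all
    then show "I (w1 @ w2) * (?X w1 * ?Y w2)
      = (\<Sum>p\<in>words \<beta>. \<Sum>g\<in>words \<gamma>. \<Sum>h\<in>words \<gamma>. \<Sum>q\<in>words \<alpha>. T (p @ q) * nested_eps g h
        * ((?X w1 * permanent (mat 1) w1 (p @ g)) * (?Y w2 * permanent (mat 1) w2 (h @ q)))
          / (fact ?a * fact ?b))"
      unfolding I_def iota_apply[OF \<open>length w1 = ?a\<close> \<open>length w2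
          = ?b\<close>] sum_divide_distrib sum_distrib_right
      by (intro sum.cong refl) (simp add: mult_ac)
  qed
  also have "(\<Sum>w1\<in>words ?a. \<Sum>w2\<in>words ?b.
      \<Sum>p\<in>words \<beta>. \<Sum>g\<in>words \<gamma>. \<Sum>h\<in>words \<gamma>. \<Sum>q\<in>words \<alpha>. T (p @ q) * nested_eps g h
        * ((?X w1 * permanent (mat 1) w1 (p @ g)) * (?Y w2 * permanent (mat 1) w2 (h @ q))))
    = (\<Sum>p\<in>words \<beta>. \<Sum>g\<in>words \<gamma>. \<Sum>h\<in>words \<gamma>. \<Sum>q\<in>words \<alpha>. \<Sum>w1\<in>words ?a. \<Sum>w2\<in>words ?b.
      T (p @ q) * nested_eps g h
        * ((?X w1 * permanent (mat 1) w1 (p @ g)) * (?Y w2 * permanent (mat 1) w2 (h @ q))))"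
    by (simp only: sum.swap[where A = "words ?a" and B = "words \<beta>"]
      sum.swap[where A = "words ?a" and B = "words \<gamma>"]
      sum.swap[where A = "words ?a" and B = "words \<alpha>"]
      sum.swap[where A = "words ?b" and B = "words \<beta>"]
      sum.swap[where A = "words ?b" and B = "words \<gamma>"]
      sum.swap[where A = "words ?b" and B = "words \<alpha>"])
  also have "\<dots> = (\<Sum>p\<in>words \<beta>. \<Sum>g\<in>words \<gamma>. \<Sum>h\<in>words \<gamma>. \<Sum>q\<in>words \<alpha>. T (p @ q) * nested_eps g h
        * ((\<Sum>w1\<in>words ?a. ?X w1 * permanent (mat 1) w1 (p @ g))
          * (\<Sum>w2\<in>words ?b. ?Y w2 * permanent (mat 1) w2 (h @ q))))"
    unfolding sum_product unfolding sum_distrib_left ..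
  also have "\<dots> = (\<Sum>p\<in>words \<beta>. \<Sum>g\<in>words \<gamma>. \<Sum>h\<in>words \<gamma>. \<Sum>q\<in>words \<alpha>. T (p @ q) * nested_eps g h
        * (permanent x z1 (p @ g) * permanent y z2 (h @ q)))"
    using assms by (intro sum.cong refl) (simp add: permanent_collapse)
  also have "\<dots> = (\<Sum>p\<in>words \<beta>. \<Sum>q\<in>words \<alpha>. \<Sum>g\<in>words \<gamma>. \<Sum>h\<in>words \<gamma>. T (p @ q) * nested_eps g h
        * (permanent x z1 (p @ g) * permanent y z2 (h @ q)))"
    by (intro sum.cong refl sum_rotate)
  finally show ?thesis unfolding I_def .
qed

lemma whisker_cap_apply:
  assumes "p \<in> words \<beta>" "q \<in> words \<alpha>"
  shows "whisker \<beta> \<alpha> (2 * \<gamma>) (cap \<gamma>) S (p @ q)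
    = (\<Sum>g\<in>words \<gamma>. \<Sum>h\<in>words \<gamma>. S ((p @ g) @ (h @ q)) * nested_eps g h)"
proof -
  have *: "cap \<gamma> (basis_tensor (g @ h)) [] = nested_eps g h"
    if "g \<in> words \<gamma>" "h \<in> words \<gamma>" for g h
  proof -
    have "cap \<gamma> (basis_tensor (g @ h)) []
      = (\<Sum>g'\<in>words \<gamma>. \<Sum>h'\<in>words \<gamma>. if h' = h then (if g' = g then nested_eps g h else 0) else 0)"
      unfolding cap_apply using that by (intro sum.cong refl) (auto simp: basis_tensor_apply)
    then show ?thesis using that by simp
  qed
  have "whisker \<beta> \<alpha> (2 * \<gamma>) (cap \<gamma>) S (p @ [] @ q)
    = (\<Sum>u\<in>words (2 * \<gamma>). S (p @ u @ q) * cap \<gamma> (basis_tensor u) [])"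
    using assms by (intro whisker_apply[where m' = 0] cap_tpow)
        (simp_all add: basis_tensor_tpow mult_2)
  also have "\<dots> = (\<Sum>g\<in>words \<gamma>. \<Sum>h\<in>words \<gamma>. S (p @ (g @ h) @ q) * nested_eps g h)"
    unfolding mult_2 sum_words_append by (intro sum.cong refl) (simp only: *)
  finally show ?thesis by simp
qed

text \<open>
  Both sides are the same sum over words: each of the three symmetrizers contributes a permanent
  and the inverse of a factorial, each vertex a nested determinant.
\<close>

lemma central_fun_eq_theta:
  "central_fun (\<beta> + \<gamma>) (\<gamma> + \<alpha>) (\<beta> + \<alpha>) x y
    = theta x y \<alpha> \<beta> \<gamma> / (fact (\<beta> + \<gamma>) * fact (\<gamma> + \<alpha>) * fact (\<beta> + \<alpha>))"
proof -
  let ?a = "\<beta> + \<gamma>" and ?b = "\<gamma> + \<alpha>" and ?c = "\<beta> + \<alpha>"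
  define A where "A = tensor_map ?a ?b (tpow_map ?a x) (tpow_map ?b y) \<circ> iota ?a ?b ?c"
  define M where "M = whisker \<beta> \<alpha> (2 * \<gamma>) (cap \<gamma>) \<circ> A"
  have lin: "tensor_linear M"
    unfolding M_def A_def iota_def
    by (intro tensor_linear_comp tensor_linear_tensor_map tensor_linear_whisker)
  have "proj ?a ?b ?c \<circ> tensor_map ?a ?b (tpow_map ?a x) (tpow_map ?b y) \<circ> iota ?a ?b ?c
      = symmetrizer ?c \<circ> M"
    by (simp add: M_def A_def proj_def adm_alpha_def adm_beta_def adm_gamma_def comp_assoc)
  then have "central_fun ?a ?b ?c x y = (\<Sum>w\<in>words ?c. M (symmetrizer ?c (basis_tensor w)) w)"
    using admissible_sum by (simp add: central_fun_def trace_on_sympow[OF lin])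
  also have "\<dots> = (\<Sum>p\<in>words \<beta>. \<Sum>q\<in>words \<alpha>. M (symmetrizer ?c (basis_tensor (p @ q))) (p @ q))"
    by (rule sum_words_append)
  also have "\<dots> = (\<Sum>p\<in>words \<beta>. \<Sum>q\<in>words \<alpha>. \<Sum>g\<in>words \<gamma>. \<Sum>h\<in>words \<gamma>.
     \<Sum>p'\<in>words \<beta>. \<Sum>q'\<in>words \<alpha>. \<Sum>g'\<in>words \<gamma>. \<Sum>h'\<in>words \<gamma>.
       nested_eps g' h' * nested_eps g h * permanent x (p @ g) (p' @ g')
         * permanent y (h @ q) (h' @ q') * permanent (mat 1) (p @ q) (p' @ q'))
      / (fact ?a * fact ?b * fact ?c)"
    unfolding sum_divide_distrib
  proof (intro sum.cong refl)
    fix p q assume pq: "p \<in> words \<beta>" "q \<in> words \<alpha>"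
    define T where "T = symmetrizer ?c (basis_tensor (p @ q))"
    have T: "T (p' @ q') = permanent (mat 1) (p @ q) (p' @ q') / fact ?c"
      if "p' \<in> words \<beta>" "q' \<in> words \<alpha>" for p' q'
      unfolding T_def using pq that
      by (simp add: symmetrizer_basis(2) permanent_one_commute[of "p @ q"])
    have "M T (p @ q) = (\<Sum>g\<in>words \<gamma>. \<Sum>h\<in>words \<gamma>. A T ((p @ g) @ (h @ q)) * nested_eps g h)"
      unfolding M_def using whisker_cap_apply[OF pq] by simp
    also have "\<dots> = (\<Sum>g\<in>words \<gamma>. \<Sum>h\<in>words \<gamma>. (\<Sum>p'\<in>words \<beta>. \<Sum>q'\<in>words \<alpha>. \<Sum>g'\<in>words \<gamma>. \<Sum>h'\<in>words \<gamma>.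
       T (p' @ q') * nested_eps g' h' * (permanent x (p @ g) (p' @ g') * permanent y (h @ q)
           (h' @ q')))
         / (fact ?a * fact ?b) * nested_eps g h)"
      unfolding A_def comp_def using pq
      by (intro sum.cong refl arg_cong2[where f = "(*)"] tensor_map_tpow_map_iota_apply) simp_all
    also have "\<dots> = (\<Sum>g\<in>words \<gamma>. \<Sum>h\<in>words \<gamma>. \<Sum>p'\<in>words \<beta>. \<Sum>q'\<in>words \<alpha>. \<Sum>g'\<in>words \<gamma>. \<Sum>h'\<in>words \<gamma>.
       nested_eps g' h' * nested_eps g h * permanent x (p @ g) (p' @ g')
         * permanent y (h @ q) (h' @ q') * permanent (mat 1) (p @ q) (p' @ q')
         / (fact ?a * fact ?b * fact ?c))"
      unfolding sum_divide_distrib sum_distrib_right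
      by (intro sum.cong refl) (simp add: T mult_ac)
    finally show "M (symmetrizer ?c (basis_tensor (p @ q))) (p @ q)
       = (\<Sum>g\<in>words \<gamma>. \<Sum>h\<in>words \<gamma>. \<Sum>p'\<in>words \<beta>. \<Sum>q'\<in>words \<alpha>. \<Sum>g'\<in>words \<gamma>. \<Sum>h'\<in>words \<gamma>.
       nested_eps g' h' * nested_eps g h * permanent x (p @ g) (p' @ g')
         * permanent y (h @ q) (h' @ q') * permanent (mat 1) (p @ q) (p' @ q')
         / (fact ?a * fact ?b * fact ?c))"
      unfolding T_def .
  qed
  finally show ?thesis unfolding theta_expand .
qed

section \<open>The recurrence for central functions\<close>

lemma fact_two_less:
  fixes n :: nat
  shows "(fact (n + 2) :: complex) = of_nat (n + 2) * (of_nat (n + 2) - 1) * fact n"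
  by (simp add: numeral_2_eq_2 algebra_simps)

lemma quotient_cancel:
  fixes n m n' m' F F' B C k s t :: "'a :: field_char_0"
  shows "(2 * k)\<^sup>2 / (4 * n * m) * (t / (F * B * C)) = k\<^sup>2 * t / (n * m * F * B * C)"
    and "(2 * k)\<^sup>2 / (4 * n * m) * (t / (C * B * F)) = k\<^sup>2 * t / (C * B * (n * m * F))"
    and "(2 * s)\<^sup>2 * (2 * k)\<^sup>2 / (16 * n * m * n' * m') * (t / (F * B * F'))
      = k\<^sup>2 * s\<^sup>2 * t / (n * m * F * B * (n' * m' * F'))"
  by (simp_all add: power_mult_distrib mult_ac)

text \<open>
  The lowered triple is admissible exactly if \<open>\<gamma> > 0\<close>; for \<open>\<gamma> = 0\<close> both coefficients vanish. The
  same applies, with \<open>\<alpha>\<close> and \<open>\<beta>\<close>, to the other two terms.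
\<close>

lemma shift_a:
  assumes "a = \<beta> + \<gamma> + 1" "b = \<gamma> + \<alpha>" "c = \<beta> + \<alpha> + 1"
  shows "(of_nat a + of_nat b - of_nat c)\<^sup>2 / (4 * of_nat a
      * (of_nat a - 1)) * central_fun (a - 2) b c x y
    = of_nat (\<gamma>\<^sup>2) * theta x y (\<alpha> + 1) \<beta> (\<gamma> - 1) / (fact a * fact b * fact c)"
proof (cases \<gamma>)
  case 0
  then show ?thesis by (simp add: assms)
next
  case (Suc g)
  have a: "a = \<beta> + g + 2" and b: "b = g + (\<alpha> + 1)" and c: "c = \<beta> + (\<alpha> + 1)"
    using assms Suc by simp_all
  have coef: "of_nat a + of_nat b - of_nat c = (2 * of_nat \<gamma> :: complex)"
    by (simp add: assms)
  have fa: "fact a = of_nat a * (of_nat a - 1) * (fact (\<beta> + g) :: complex)"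
    unfolding a by (rule fact_two_less)
  have cf: "central_fun (a - 2) b c x y
    = theta x y (\<alpha> + 1) \<beta> (\<gamma> - 1) / (fact (\<beta> + g) * fact b * fact c)"
    unfolding b c using central_fun_eq_theta[of \<beta> g "\<alpha> + 1"] a Suc by simp
  show ?thesis unfolding coef fa cf of_nat_power by (rule quotient_cancel(1))
qed

lemma shift_c:
  assumes "a = \<beta> + \<gamma> + 1" "b = \<gamma> + \<alpha>" "c = \<beta> + \<alpha> + 1"
  shows "(- of_nat a + of_nat b + of_nat c)\<^sup>2 / (4 * of_nat c
      * (of_nat c - 1)) * central_fun a b (c - 2) x y
    = of_nat (\<alpha>\<^sup>2) * theta x y (\<alpha> - 1) \<beta> (\<gamma> + 1) / (fact a * fact b * fact c)"
proof (cases \<alpha>)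
  case 0
  then show ?thesis by (simp add: assms)
next
  case (Suc k)
  have c: "c = \<beta> + k + 2" and b: "b = (\<gamma> + 1) + k" and a: "a = \<beta> + (\<gamma> + 1)"
    using assms Suc by simp_all
  have coef: "- of_nat a + of_nat b + of_nat c = (2 * of_nat \<alpha> :: complex)"
    by (simp add: assms)
  have fc: "fact c = of_nat c * (of_nat c - 1) * (fact (\<beta> + k) :: complex)"
    unfolding c by (rule fact_two_less)
  have cf: "central_fun a b (c - 2) x y
    = theta x y (\<alpha> - 1) \<beta> (\<gamma> + 1) / (fact a * fact b * fact (\<beta> + k))"
    unfolding a b using central_fun_eq_theta[of \<beta> "\<gamma> + 1" k] c Suc by simp
  show ?thesis unfolding coef fc cf of_nat_power by (rule quotient_cancel(2))
qed

lemma shift_ac: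
  assumes "a = \<beta> + \<gamma> + 1" "b = \<gamma> + \<alpha>" "c = \<beta> + \<alpha> + 1"
  shows "(of_nat a + of_nat b + of_nat c)\<^sup>2 * (of_nat a - of_nat b + of_nat c - 2)\<^sup>2
      / (16 * of_nat a * (of_nat a - 1) * of_nat c
          * (of_nat c - 1)) * central_fun (a - 2) b (c - 2) x y
    = of_nat (\<beta>\<^sup>2 * (\<alpha> + \<beta> + \<gamma> + 1)\<^sup>2) * theta x y \<alpha> (\<beta> - 1) \<gamma> / (fact a * fact b * fact c)"
proof -
  have sums: "of_nat a - of_nat b + of_nat c - 2 = (2 * of_nat \<beta> :: complex)"
    "of_nat a + of_nat b + of_nat c = (2 * of_nat (\<alpha> + \<beta> + \<gamma> + 1) :: complex)"
    by (simp_all add: assms)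
  show ?thesis
  proof (cases \<beta>)
    case 0
    then show ?thesis unfolding sums by simp
  next
    case (Suc k)
    have a: "a = k + \<gamma> + 2" and c: "c = k + \<alpha> + 2"
      using assms Suc by simp_all
    have fa: "fact a = of_nat a * (of_nat a - 1) * (fact (k + \<gamma>) :: complex)"
      unfolding a by (rule fact_two_less)
    have fc: "fact c = of_nat c * (of_nat c - 1) * (fact (k + \<alpha>) :: complex)"
      unfolding c by (rule fact_two_less)
    have cf: "central_fun (a - 2) b (c - 2) x y
      = theta x y \<alpha> (\<beta> - 1) \<gamma> / (fact (k + \<gamma>) * fact b * fact (k + \<alpha>))"
      using central_fun_eq_theta[of k \<gamma> \<alpha>] a c assms(2) Suc by simp
    show ?thesis unfolding sums fa fc cf of_nat_power of_nat_mult by (rule quotient_cancel(3))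
  qed
qed

lemma central_fun_recurrence:
  assumes "a = \<beta> + \<gamma> + 1" "b = \<gamma> + \<alpha>" "c = \<beta> + \<alpha> + 1" and "det x = 1"
  shows "central_fun a b c x y =
      trace x * central_fun (a - 1) b (c - 1) x y
      - (of_nat a + of_nat b - of_nat c)\<^sup>2 / (4 * of_nat a
          * (of_nat a - 1)) * central_fun (a - 2) b c x y
      - (- of_nat a + of_nat b + of_nat c)\<^sup>2 / (4 * of_nat c
          * (of_nat c - 1)) * central_fun a b (c - 2) x y
      - (of_nat a + of_nat b + of_nat c)\<^sup>2 * (of_nat a - of_nat b + of_nat c - 2)\<^sup>2
          / (16 * of_nat a * (of_nat a - 1) * of_nat c
              * (of_nat c - 1)) * central_fun (a - 2) b (c - 2) x y"
proof -
  have "a = Suc \<beta> + \<gamma>" "c = Suc \<beta> + \<alpha>" using assms by simp_all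
  then have top: "central_fun a b c x y = theta x y \<alpha> (Suc \<beta>) \<gamma> / (fact a * fact b * fact c)"
    using central_fun_eq_theta[of "Suc \<beta>" \<gamma> \<alpha>] assms(2) by (simp only:)
  have "fact a = of_nat a * (fact (\<beta> + \<gamma>) :: complex)" "fact c
      = of_nat c * (fact (\<beta> + \<alpha>) :: complex)"
    by (simp_all add: assms)
  moreover have "of_nat a \<noteq> (0 :: complex)" "of_nat c \<noteq> (0 :: complex)"
    unfolding of_nat_eq_0_iff using assms by simp_all
  moreover have "central_fun (a - 1) b (c - 1) x y
     = theta x y \<alpha> \<beta> \<gamma> / (fact (\<beta> + \<gamma>) * fact b * fact (\<beta> + \<alpha>))"
    using central_fun_eq_theta[of \<beta> \<gamma> \<alpha>] assms by simp
  ultimately have first: "trace x * central_fun (a - 1) b (c - 1) x y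
     = of_nat (a * c) * trace x * theta x y \<alpha> \<beta> \<gamma> / (fact a * fact b * fact c)"
    by (simp add: mult_ac)
  have ac: "(\<beta> + \<gamma> + 1) * (\<beta> + \<alpha> + 1) = a * c" by (simp only: assms)
  show ?thesis
    unfolding top first shift_a[OF assms(1-3)] shift_c[OF assms(1-3)] shift_ac[OF assms(1-3)]
      theta_recurrence[OF assms(4)] ac diff_divide_distrib ..
qed

theorem corollary5p7:
  fixes a b c :: nat
  assumes "a \<ge> 1" and "c \<ge> 1" and "admissible (a - 1) b (c - 1)"
  shows "admissible a b c \<and>
    (a > 1 \<and> c > 1 \<longrightarrow>
      (\<forall>x1\<in>SL2. \<forall>x2\<in>SL2.
        central_fun a b c x1 x2 =
          trace x1 * central_fun (a - 1) b (c - 1) x1 x2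
          - (of_nat a + of_nat b - of_nat c)\<^sup>2 / (4 * of_nat a * (of_nat a - 1))
              * central_fun (a - 2) b c x1 x2
          - (- of_nat a + of_nat b + of_nat c)\<^sup>2 / (4 * of_nat c * (of_nat c - 1))
              * central_fun a b (c - 2) x1 x2
          - (of_nat a + of_nat b + of_nat c)\<^sup>2 * (of_nat a - of_nat b + of_nat c - 2)\<^sup>2
              / (16 * of_nat a * (of_nat a - 1) * of_nat c * (of_nat c - 1))
              * central_fun (a - 2) b (c - 2) x1 x2)) \<and>
    (a = 1 \<or> c = 1 \<longrightarrow>
      (\<forall>x1\<in>SL2. \<forall>x2\<in>SL2.
        central_fun a b c x1 x2 =
          trace x1 * central_fun (a - 1) b (c - 1) x1 x2
          - (if a = 1 then 0 else
              (of_nat a + of_nat b - of_nat c)\<^sup>2 / (4 * of_nat a * (of_nat a - 1))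
                * central_fun (a - 2) b c x1 x2)
          - (if c = 1 then 0 else
              (- of_nat a + of_nat b + of_nat c)\<^sup>2 / (4 * of_nat c * (of_nat c - 1))
                * central_fun a b (c - 2) x1 x2)
          - (if a = 1 \<or> c = 1 then 0 else
              (of_nat a + of_nat b + of_nat c)\<^sup>2 * (of_nat a - of_nat b + of_nat c - 2)\<^sup>2
                / (16 * of_nat a * (of_nat a - 1) * of_nat c * (of_nat c - 1))
                * central_fun (a - 2) b (c - 2) x1 x2)))"
proof -
  obtain \<alpha> \<beta> \<gamma> where "a - 1 = \<beta> + \<gamma>" and b: "b = \<gamma> + \<alpha>" and "c - 1 = \<beta> + \<alpha>"
    using assms(3) by (rule admissibleE)
  then have a: "a = \<beta> + \<gamma> + 1" and c: "c = \<beta> + \<alpha> + 1"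
    using assms(1,2) by simp_all
  have adm: "admissible a b c"
    using admissible_sum[of "Suc \<beta>" \<gamma> \<alpha>] by (simp add: a b c)
  note rec = central_fun_recurrence[OF a b c]
  \<comment> \<open>A quotient by zero is zero, so the excluded terms vanish in the uniform formula as well.\<close>
  show ?thesis
  proof (intro conjI impI ballI)
    fix x1 x2 :: "complex^2^2" assume "x1 \<in> SL2"
    then have det: "det x1 = 1" by (simp add: SL2_def)
    show "central_fun a b c x1 x2 =
          trace x1 * central_fun (a - 1) b (c - 1) x1 x2
          - (of_nat a + of_nat b - of_nat c)\<^sup>2 / (4 * of_nat a * (of_nat a - 1))
              * central_fun (a - 2) b c x1 x2
          - (- of_nat a + of_nat b + of_nat c)\<^sup>2 / (4 * of_nat c * (of_nat c - 1))
              * central_fun a b (c - 2) x1 x2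
          - (of_nat a + of_nat b + of_nat c)\<^sup>2 * (of_nat a - of_nat b + of_nat c - 2)\<^sup>2
              / (16 * of_nat a * (of_nat a - 1) * of_nat c * (of_nat c - 1))
              * central_fun (a - 2) b (c - 2) x1 x2"
      by (rule rec[OF det])
    show "central_fun a b c x1 x2 =
          trace x1 * central_fun (a - 1) b (c - 1) x1 x2
          - (if a = 1 then 0 else
              (of_nat a + of_nat b - of_nat c)\<^sup>2 / (4 * of_nat a * (of_nat a - 1))
                * central_fun (a - 2) b c x1 x2)
          - (if c = 1 then 0 else
              (- of_nat a + of_nat b + of_nat c)\<^sup>2 / (4 * of_nat c * (of_nat c - 1))
                * central_fun a b (c - 2) x1 x2)
          - (if a = 1 \<or> c = 1 then 0 else
              (of_nat a + of_nat b + of_nat c)\<^sup>2 * (of_nat a - of_nat b + of_nat c - 2)\<^sup>2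
                / (16 * of_nat a * (of_nat a - 1) * of_nat c * (of_nat c - 1))
                * central_fun (a - 2) b (c - 2) x1 x2)"
      by (subst rec[OF det]) (cases "a = 1"; cases "c = 1"; simp)
  qed (rule adm)
qed

end
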